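(* Let $G$ be a real semisimple Lie group with Cartan decomposition $\mathfrak g=\mathfrak k\oplus\mathfrak p$, $G\cong K\times\mathfrak p$, let $\mathfrak a\subset\mathfrak p$ be maximal abelian, $w_0\in\mathfrak a$, $H=Z_K(w_0)$ with Lie algebra $\mathfrak h$, and let $\mathbb I$ be an inertia tensor on $\mathfrak k$. With $\Omega^K$, $\mathcal H_c$, $X_{\mathrm{nh}}$, $J_H$ and the 2-form $\Lambda$ on $TK=K\times\mathfrak k$ as defined in the context, put $$\tilde\Omega:=\Omega^K+\Lambda .$$ Then the system $(TK,\tilde\Omega,\mathcal H_c)$ has the following properties. (1) $\tilde\Omega$ is non-degenerate and $H$-basic. (2) $i(X_{\mathrm{nh}})\tilde\Omega=d\mathcal H_c$. (3) $i(\zeta_Y)\tilde\Omega=d\langle J_H,Y\rangle$ for all $Y\in\mathfrak h$.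
   Context: Let $\theta$ be the Cartan involution of $\mathfrak g$, $B$ the Killing form, $\langle\cdot,\cdot\rangle=-B(\cdot,\theta\,\cdot)$ the associated positive definite, $\mathrm{Ad}(K)$-invariant inner product. Let $H=Z_K(w_0)=\{h\in K:\mathrm{Ad}(h)w_0=w_0\}$ with Lie algebra $\mathfrak h$, $\mathfrak h^\perp$ its orthogonal complement in $\mathfrak k$, $V=\mathrm{ad}(w_0)(\mathfrak h^\perp)\subset\mathfrak p$, and $\mathfrak m=Z_{\mathfrak k}(\mathfrak a)$. The inertia tensor $\mathbb I$ is a symmetric positive definite endomorphism of $(\mathfrak k,\langle\cdot,\cdot\rangle)$. Non-holonomic system. Trivialize $TK=K\times\mathfrak k$ by left multiplication, $u=s^{-1}s'$, with projection $\tau:TK\to K$. Let $\mathcal A$ be the $V$-valued one-form on $K$ with $\mathcal A_s(u)=-[\mathrm{Ad}(s)u,w_0]$. Metric tensor: $\mu_0(s)=\mathbb I+\mathcal A_s^*\mathcal A_s=\mathbb I+\mathrm{Ad}(s^{-1})\mathrm{ad}(w_0)^2|_{\mathfrak k}\mathrm{Ad}(s)$. The metric $\langle\mu_0(s)u_1,u_2\rangle$ identifies $TK=T^*K$; $\Omega^K=-d\theta^K$ with $\theta^K_{(s,u)}(\xi)=\langle\mu_0(s)u,T\tau\,\xi\rangle$ is the canonical symplectic form. $\mathcal H_c(s,u)=\tfrac12\langle\mu_0(s)u,u\rangle$ is the compressed Hamiltonian. $X_{\mathrm{nh}}$ is defined by $i(X_{\mathrm{nh}})(\Omega^K+\langle\mathcal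 A,d\mathcal A\rangle)=d\mathcal H_c$, where $\langle\mathcal A,d\mathcal A\rangle_{(s,u)}(\xi_1,\xi_2)=\langle\mathcal A_s(u),d\mathcal A(T\tau\,\xi_1,T\tau\,\xi_2)\rangle$. Symmetry. $H$ acts on $TK$ by $h\cdot(s,u)=(hs,u)$ (lift of left multiplication on $K$); for $Y\in\mathfrak h$, $\zeta_Y$ denotes the infinitesimal generator (on $K$, in the left trivialization, $\zeta_Y(s)=\mathrm{Ad}(s^{-1})Y$). $J_H:TK\to\mathfrak h^*$ is the standard momentum map, $\langle J_H(s,u),Y\rangle=\langle\mu_0(s)u,\mathrm{Ad}(s^{-1})Y\rangle$. A form on $TK$ is called $H$-basic if it is $H$-invariant and $H$-horizontal (annihilated by insertion of the generators $\zeta_Y$, $Y\in\mathfrak h$). Bases. Let $\Sigma$ be the restricted roots of $(\mathfrak g,\mathfrak a)$, $\Sigma_+$ a choice of positive roots, $\mathfrak g_\lambda$ the root spaces, and $\Phi=\{\lambda\in\Sigma_+:\lambda(w_0)\ne0\}$. Choose an orthonormal basis $Y_\alpha$ ($1\le\alpha\le\dim\mathfrak m$) of $\mathfrak m$, an orthonormal basis $Z_{(\lambda,a)}$ ($\lambda\in\Sigma_+$, $1\le a\le\dim\mathfrak g_\lambda$) of $\mathfrak m^\perp\cap\mathfrak k$, and an orthonormal basis $e_{(\lambda,a)}$ of $\mathfrak a^\perp\cap\mathfrak p$ such that $\mathrm{ad}(w)Z_{(\lambda,a)}=\lambda(w)e_{(\lambda,a)}$ and $\mathrm{ad}(w)e_{(\lambda,a)}=\lambda(w)Z_{(\lambda,a)}$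 for all $w\in\mathfrak a$ (such bases always exist). Structure constants: $c^{\alpha}_{(\lambda,a)(\mu,b)}=\langle Y_\alpha,[Z_{(\lambda,a)},Z_{(\mu,b)}]\rangle$, $c^{(\lambda,a)}_{(\mu,b)(\nu,c)}=\langle Z_{(\lambda,a)},[Z_{(\mu,b)},Z_{(\nu,c)}]\rangle$. One-forms on $K$: $\eta^{(\lambda,a)}_s(u)=\langle Z_{(\lambda,a)},\mathrm{Ad}(s)u\rangle$ (also denoting their pull-backs to $TK$). Functions on $TK$: $l_\alpha(s,u)=\langle Y_\alpha,\mathrm{Ad}(s)u\rangle$, $g_{(\lambda,a)}(s,u)=\langle Z_{(\lambda,a)},\mathrm{Ad}(s)u\rangle$. Definition of $\Lambda$ (sums over all indices occurring, roots in $\Sigma_+$ subject to the indicated restrictions; $\alpha\wedge\beta(x,y)=\alpha(x)\beta(y)-\alpha(y)\beta(x)$): $$\Lambda:=-\tfrac12\sum\lambda(w_0)^2c^{\alpha}_{(\lambda,a)(\lambda,b)}\,l_\alpha\,\eta^{(\lambda,a)}\wedge\eta^{(\lambda,b)}-\tfrac12\sum_{\lambda\notin\Phi;\ \mu,\nu\in\Phi}\mu(w_0)^2c^{(\lambda,a)}_{(\mu,b)(\nu,c)}\,g_{(\lambda,a)}\,\eta^{(\mu,b)}\wedge\eta^{(\nu,c)}+\tfrac12\sum_{\mu,\nu\in\Phi}\lambda(w_0)^2c^{(\lambda,a)}_{(\mu,b)(\nu,c)}\,g_{(\lambda,a)}\,\eta^{(\mu,b)}\wedge\eta^{(\nu,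c)}.$$
   Formalization: As stated, (1) fails whenever 𝔥 ≠ 0, since by (3) a nonzero ζ_Y is not annihilated by Ω̃. It is replaced by: Ω̃ is non-degenerate and H-invariant, and Λ is H-basic (H-invariant and H-horizontal). (2) and (3) are unchanged. *)

theory Defs
  imports "HOL-Analysis.Analysis" "HOL-Algebra.Group"
begin

section \<open>Smooth manifolds and Lie groups\<close>

primrec k_smooth_on ::
  "nat \<Rightarrow> ('x::real_normed_vector \<Rightarrow> 'y::real_normed_vector) \<Rightarrow> 'x set \<Rightarrow> bool" where
  "k_smooth_on 0 f S \<longleftrightarrow> continuous_on S f"
| "k_smooth_on (Suc k) f S \<longleftrightarrow> (\<forall>x\<in>S. f differentiable (at x)) \<and>
     (\<forall>v. k_smooth_on k (\<lambda>x. frechet_derivative f (at x) v) S)"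

definition smooth_on ::
  "('x::real_normed_vector \<Rightarrow> 'y::real_normed_vector) \<Rightarrow> 'x set \<Rightarrow> bool" where
  "smooth_on f S \<longleftrightarrow> (\<forall>k. k_smooth_on k f S)"

text \<open>A chart is a pair of its domain \<open>U\<close> and a function that is only meaningful on \<open>U\<close>.\<close>

type_synonym ('a, 'e) chart = "'a set \<times> ('a \<Rightarrow> 'e)"

definition smooth_manifold :: "'a topology \<Rightarrow> ('a, 'e::euclidean_space) chart set \<Rightarrow> bool" where
  "smooth_manifold X A \<longleftrightarrow>
     Hausdorff_space X \<and> second_countable X \<and> (\<Union>c\<in>A. fst c) = topspace X \<and>
     (\<forall>(U, \<phi>)\<in>A. openin X U \<and> open (\<phi> ` U) \<and>
        homeomorphic_map (subtopology X U) (top_of_set (\<phi> ` U)) \<phi>) \<and>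
     (\<forall>(U, \<phi>)\<in>A. \<forall>(V, \<psi>)\<in>A. smooth_on (\<psi> \<circ> inv_into U \<phi>) (\<phi> ` (U \<inter> V)))"

definition smooth_map ::
  "'a topology \<Rightarrow> ('a, 'e::euclidean_space) chart set \<Rightarrow>
   'b topology \<Rightarrow> ('b, 'f::euclidean_space) chart set \<Rightarrow> ('a \<Rightarrow> 'b) \<Rightarrow> bool" where
  "smooth_map X A X' A' f \<longleftrightarrow> continuous_map X X' f \<and>
     (\<forall>(U, \<phi>)\<in>A. \<forall>(V, \<psi>)\<in>A'.
        smooth_on (\<psi> \<circ> f \<circ> inv_into U \<phi>) (\<phi> ` {x \<in> U. f x \<in> V}))"

definition prod_charts ::
  "('a, 'e) chart set \<Rightarrow> ('b, 'f) chart set \<Rightarrow> ('a \<times> 'b, 'e \<times> 'f) chart set" where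
  "prod_charts A A' = {(U \<times> V, map_prod \<phi> \<psi>) | U \<phi> V \<psi>. (U, \<phi>) \<in> A \<and> (V, \<psi>) \<in> A'}"

record ('a, 'g) lie_group_data = "'a monoid" +
  topo :: "'a topology"
  charts :: "('a, 'g) chart set"

definition lie_group :: "('a, 'g::euclidean_space) lie_group_data \<Rightarrow> bool" where
  "lie_group G \<longleftrightarrow> group G \<and> topspace (topo G) = carrier G \<and>
     smooth_manifold (topo G) (charts G) \<and>
     smooth_map (prod_topology (topo G) (topo G)) (prod_charts (charts G) (charts G))
       (topo G) (charts G) (\<lambda>(x, y). x \<otimes>\<^bsub>G\<^esub> y) \<and>
     smooth_map (topo G) (charts G) (topo G) (charts G) (\<lambda>x. inv\<^bsub>G\<^esub> x)"

text \<open>The Lie algebra, i.e. the tangent space at the identity, is identified with the model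
  space \<open>'g\<close> by the coordinates of some chart around the identity. The inner product that
  \<open>'g\<close> carries as a Euclidean space plays no role: \<open>'g\<close> is used as a finite-dimensional
  real vector space only.\<close>

definition id_chart :: "('a, 'g::euclidean_space) lie_group_data \<Rightarrow> ('a, 'g) chart" where
  "id_chart G = (SOME c. c \<in> charts G \<and> \<one>\<^bsub>G\<^esub> \<in> fst c)"

definition coord :: "('a, 'g::euclidean_space) lie_group_data \<Rightarrow> 'a \<Rightarrow> 'g" where
  "coord G = snd (id_chart G)"

definition uncoord :: "('a, 'g::euclidean_space) lie_group_data \<Rightarrow> 'g \<Rightarrow> 'a" where
  "uncoord G = inv_into (fst (id_chart G)) (coord G)"

definition Ad :: "('a, 'g::euclidean_space) lie_group_data \<Rightarrow> 'a \<Rightarrow> 'g \<Rightarrow> 'g" where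
  "Ad G s = frechet_derivative
     (\<lambda>z. coord G (s \<otimes>\<^bsub>G\<^esub> uncoord G z \<otimes>\<^bsub>G\<^esub> inv\<^bsub>G\<^esub> s)) (at (coord G \<one>\<^bsub>G\<^esub>))"

text \<open>The bracket is the derivative of \<open>Ad\<close> at the identity, \<open>[x, y] = ad(x) y\<close>; this is the
  bracket of left invariant vector fields.\<close>

definition bracket :: "('a, 'g::euclidean_space) lie_group_data \<Rightarrow> 'g \<Rightarrow> 'g \<Rightarrow> 'g" where
  "bracket G x y = frechet_derivative (\<lambda>z. Ad G (uncoord G z) y) (at (coord G \<one>\<^bsub>G\<^esub>)) x"

definition one_param_subgroup ::
  "('a, 'g::euclidean_space) lie_group_data \<Rightarrow> 'g \<Rightarrow> (real \<Rightarrow> 'a) \<Rightarrow> bool" where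
  "one_param_subgroup G x \<gamma> \<longleftrightarrow> continuous_map euclideanreal (topo G) \<gamma> \<and>
     (\<forall>t t'. \<gamma> (t + t') = \<gamma> t \<otimes>\<^bsub>G\<^esub> \<gamma> t') \<and>
     ((\<lambda>t. coord G (\<gamma> t)) has_vector_derivative x) (at 0)"

text \<open>In a Lie group there is exactly one one-parameter subgroup with a given initial velocity
  \<open>x\<close>, namely \<open>t \<mapsto> exp (t x)\<close>; so the choice operator makes no choice.\<close>

definition exp_curve :: "('a, 'g::euclidean_space) lie_group_data \<Rightarrow> 'g \<Rightarrow> real \<Rightarrow> 'a" where
  "exp_curve G x = (SOME \<gamma>. one_param_subgroup G x \<gamma>)"

definition lie_exp :: "('a, 'g::euclidean_space) lie_group_data \<Rightarrow> 'g \<Rightarrow> 'a" where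
  "lie_exp G x = exp_curve G x 1"

text \<open>The Lie algebra of a closed subgroup.\<close>

definition Lie :: "('a, 'g::euclidean_space) lie_group_data \<Rightarrow> 'a set \<Rightarrow> 'g set" where
  "Lie G S = {x. \<exists>\<gamma>. one_param_subgroup G x \<gamma> \<and> range \<gamma> \<subseteq> S}"


section \<open>Semisimple Lie algebras, Cartan decomposition, restricted roots\<close>

definition lie_ideal :: "('g::real_vector \<Rightarrow> 'g \<Rightarrow> 'g) \<Rightarrow> 'g set \<Rightarrow> bool" where
  "lie_ideal br I \<longleftrightarrow> subspace I \<and> (\<forall>x. \<forall>y\<in>I. br x y \<in> I)"

primrec derived_series :: "('g::real_vector \<Rightarrow> 'g \<Rightarrow> 'g) \<Rightarrow> 'g set \<Rightarrow> nat \<Rightarrow> 'g set" where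
  "derived_series br I 0 = I"
| "derived_series br I (Suc n) =
     span {br x y | x y. x \<in> derived_series br I n \<and> y \<in> derived_series br I n}"

definition semisimple :: "('g::real_vector \<Rightarrow> 'g \<Rightarrow> 'g) \<Rightarrow> bool" where
  "semisimple br \<longleftrightarrow> (\<forall>I. lie_ideal br I \<and> (\<exists>n. derived_series br I n = {0}) \<longrightarrow> I = {0})"

definition lin_trace :: "('g::euclidean_space \<Rightarrow> 'g) \<Rightarrow> real" where
  "lin_trace f = (\<Sum>b\<in>Basis. inner (f b) b)"

definition killing :: "('g::euclidean_space \<Rightarrow> 'g \<Rightarrow> 'g) \<Rightarrow> 'g \<Rightarrow> 'g \<Rightarrow> real" where
  "killing br x y = lin_trace (\<lambda>z. br x (br y z))"

text \<open>The inner product \<open>-B(x, \<theta> y)\<close>, for the bracket of \<open>G\<close>.\<close>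

definition ip :: "('a, 'g::euclidean_space) lie_group_data \<Rightarrow> ('g \<Rightarrow> 'g) \<Rightarrow> 'g \<Rightarrow> 'g \<Rightarrow> real" where
  "ip G \<theta> x y = - killing (bracket G) x (\<theta> y)"

definition cartan_involution ::
  "('a, 'g::euclidean_space) lie_group_data \<Rightarrow> ('g \<Rightarrow> 'g) \<Rightarrow> bool" where
  "cartan_involution G \<theta> \<longleftrightarrow> linear \<theta> \<and> (\<forall>x. \<theta> (\<theta> x) = x) \<and>
     (\<forall>x y. \<theta> (bracket G x y) = bracket G (\<theta> x) (\<theta> y)) \<and>
     (\<forall>x. x \<noteq> 0 \<longrightarrow> ip G \<theta> x x > 0)"

definition k_part :: "('g::real_vector \<Rightarrow> 'g) \<Rightarrow> 'g set" where
  "k_part \<theta> = {x. \<theta> x = x}"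

definition p_part :: "('g::real_vector \<Rightarrow> 'g) \<Rightarrow> 'g set" where
  "p_part \<theta> = {x. \<theta> x = - x}"

text \<open>\<open>K\<close> is a closed subgroup with Lie algebra \<open>\<kk>\<close> and \<open>(s, x) \<mapsto> s exp(x)\<close> is a diffeomorphism
  from \<open>K \<times> \<pp>\<close> onto \<open>G\<close>. This map is always smooth; since \<open>K\<close> is closed, hence embedded, its
  inverse is smooth if and only if its two components are smooth as maps into \<open>G\<close> and \<open>'g\<close>.\<close>

definition global_cartan_decomposition ::
  "('a, 'g::euclidean_space) lie_group_data \<Rightarrow> ('g \<Rightarrow> 'g) \<Rightarrow> 'a set \<Rightarrow> bool" where
  "global_cartan_decomposition G \<theta> K \<longleftrightarrow>
     subgroup K G \<and> closedin (topo G) K \<and> Lie G K = k_part \<theta> \<and>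
     (let F = (\<lambda>(s, x). s \<otimes>\<^bsub>G\<^esub> lie_exp G x); D = K \<times> p_part \<theta>; F' = inv_into D F
      in bij_betw F D (carrier G) \<and>
         smooth_map (topo G) (charts G) (topo G) (charts G) (\<lambda>g. fst (F' g)) \<and>
         smooth_map (topo G) (charts G) euclidean {(UNIV, \<lambda>x. x)} (\<lambda>g. snd (F' g)))"

definition abelian_subspace :: "('g::real_vector \<Rightarrow> 'g \<Rightarrow> 'g) \<Rightarrow> 'g set \<Rightarrow> bool" where
  "abelian_subspace br \<aa> \<longleftrightarrow> subspace \<aa> \<and> (\<forall>x\<in>\<aa>. \<forall>y\<in>\<aa>. br x y = 0)"

definition maximal_abelian :: "('g::real_vector \<Rightarrow> 'g \<Rightarrow> 'g) \<Rightarrow> 'g set \<Rightarrow> 'g set \<Rightarrow> bool" where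
  "maximal_abelian br \<pp> \<aa> \<longleftrightarrow> \<aa> \<subseteq> \<pp> \<and> abelian_subspace br \<aa> \<and>
     (\<forall>\<bb>. \<bb> \<subseteq> \<pp> \<and> abelian_subspace br \<bb> \<and> \<aa> \<subseteq> \<bb> \<longrightarrow> \<bb> = \<aa>)"

definition root_space ::
  "('g::real_vector \<Rightarrow> 'g \<Rightarrow> 'g) \<Rightarrow> 'g set \<Rightarrow> ('g \<Rightarrow> real) \<Rightarrow> 'g set" where
  "root_space br \<aa> \<rho> = {x. \<forall>w\<in>\<aa>. br w x = \<rho> w *\<^sub>R x}"

text \<open>Linear functionals on \<open>\<aa>\<close> are represented by functions that are \<open>undefined\<close> outside \<open>\<aa>\<close>,
  so that equality of functions is equality of functionals on \<open>\<aa>\<close>.\<close>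

definition restricted_roots ::
  "('g::real_vector \<Rightarrow> 'g \<Rightarrow> 'g) \<Rightarrow> 'g set \<Rightarrow> ('g \<Rightarrow> real) set" where
  "restricted_roots br \<aa> = {\<rho> \<in> extensional \<aa>.
     (\<forall>v\<in>\<aa>. \<forall>w\<in>\<aa>. \<rho> (v + w) = \<rho> v + \<rho> w) \<and> (\<forall>c. \<forall>w\<in>\<aa>. \<rho> (c *\<^sub>R w) = c * \<rho> w) \<and>
     (\<exists>w\<in>\<aa>. \<rho> w \<noteq> 0) \<and> root_space br \<aa> \<rho> \<noteq> {0}}"

text \<open>A choice of positive roots: the roots that are positive on an open Weyl chamber.\<close>

definition positive_roots ::
  "('g::real_vector \<Rightarrow> 'g \<Rightarrow> 'g) \<Rightarrow> 'g set \<Rightarrow> ('g \<Rightarrow> real) set \<Rightarrow> bool" where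
  "positive_roots br \<aa> P \<longleftrightarrow> (\<exists>w\<in>\<aa>. (\<forall>\<rho>\<in>restricted_roots br \<aa>. \<rho> w \<noteq> 0) \<and>
     P = {\<rho>\<in>restricted_roots br \<aa>. \<rho> w > 0})"

definition m_part :: "('g::real_vector \<Rightarrow> 'g \<Rightarrow> 'g) \<Rightarrow> ('g \<Rightarrow> 'g) \<Rightarrow> 'g set \<Rightarrow> 'g set" where
  "m_part br \<theta> \<aa> = {x \<in> k_part \<theta>. \<forall>w\<in>\<aa>. br x w = 0}"

definition ortho :: "('g::real_vector \<Rightarrow> 'g \<Rightarrow> real) \<Rightarrow> 'g set \<Rightarrow> 'g set" where
  "ortho f W = {x. \<forall>w\<in>W. f w x = 0}"

definition orthonormal_basis ::
  "('g::real_vector \<Rightarrow> 'g \<Rightarrow> real) \<Rightarrow> 'g set \<Rightarrow> 'i set \<Rightarrow> ('i \<Rightarrow> 'g) \<Rightarrow> bool" where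
  "orthonormal_basis f W I b \<longleftrightarrow>
     (\<forall>i\<in>I. \<forall>j\<in>I. f (b i) (b j) = (if i = j then 1 else 0)) \<and> span (b ` I) = W"

definition root_indices ::
  "('g::euclidean_space \<Rightarrow> 'g \<Rightarrow> 'g) \<Rightarrow> 'g set \<Rightarrow> ('g \<Rightarrow> real) set \<Rightarrow> (('g \<Rightarrow> real) \<times> nat) set" where
  "root_indices br \<aa> P = (SIGMA \<rho>:P. {1..dim (root_space br \<aa> \<rho>)})"

definition adapted_bases ::
  "('a, 'g::euclidean_space) lie_group_data \<Rightarrow> ('g \<Rightarrow> 'g) \<Rightarrow> 'g set \<Rightarrow> ('g \<Rightarrow> real) set \<Rightarrow>
   (nat \<Rightarrow> 'g) \<Rightarrow> (('g \<Rightarrow> real) \<times> nat \<Rightarrow> 'g) \<Rightarrow> (('g \<Rightarrow> real) \<times> nat \<Rightarrow> 'g) \<Rightarrow> bool" where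
  "adapted_bases G \<theta> \<aa> P Y Z e \<longleftrightarrow>
     (let br = bracket G; f = ip G \<theta>; \<mm> = m_part br \<theta> \<aa>; I = root_indices br \<aa> P
      in orthonormal_basis f \<mm> {1..dim \<mm>} Y \<and>
         orthonormal_basis f (ortho f \<mm> \<inter> k_part \<theta>) I Z \<and>
         orthonormal_basis f (ortho f \<aa> \<inter> p_part \<theta>) I e \<and>
         (\<forall>w\<in>\<aa>. \<forall>(\<rho>, a)\<in>I.
            br w (Z (\<rho>, a)) = \<rho> w *\<^sub>R e (\<rho>, a) \<and> br w (e (\<rho>, a)) = \<rho> w *\<^sub>R Z (\<rho>, a)))"

definition inertia_tensor ::
  "('g::real_vector \<Rightarrow> 'g \<Rightarrow> real) \<Rightarrow> 'g set \<Rightarrow> ('g \<Rightarrow> 'g) \<Rightarrow> bool" where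
  "inertia_tensor f \<kk> \<I> \<longleftrightarrow>
     (\<forall>x\<in>\<kk>. \<I> x \<in> \<kk>) \<and>
     (\<forall>x\<in>\<kk>. \<forall>y\<in>\<kk>. \<I> (x + y) = \<I> x + \<I> y) \<and> (\<forall>c. \<forall>x\<in>\<kk>. \<I> (c *\<^sub>R x) = c *\<^sub>R \<I> x) \<and>
     (\<forall>x\<in>\<kk>. \<forall>y\<in>\<kk>. f (\<I> x) y = f x (\<I> y)) \<and>
     (\<forall>x\<in>\<kk>. x \<noteq> 0 \<longrightarrow> f (\<I> x) x > 0)"


section \<open>Forms on \<open>TK\<close> in the left trivialization\<close>

text \<open>Points of \<open>TK\<close> are pairs \<open>(s, u) \<in> K \<times> \<kk>\<close>. A tangent vector \<open>(s', u')\<close> at \<open>(s, u)\<close> is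
  represented by \<open>(s\<inverse> s', u') \<in> \<kk> \<times> \<kk>\<close>; in particular \<open>T\<tau>\<close> is \<open>fst\<close>. A two-form assigns to each
  point a function of two tangent vectors.\<close>

type_synonym ('a, 'g) one_form = "'a \<times> 'g \<Rightarrow> 'g \<times> 'g \<Rightarrow> real"
type_synonym ('a, 'g) two_form = "'a \<times> 'g \<Rightarrow> 'g \<times> 'g \<Rightarrow> 'g \<times> 'g \<Rightarrow> real"

definition TK :: "'a set \<Rightarrow> ('g::real_vector \<Rightarrow> 'g) \<Rightarrow> ('a \<times> 'g) set" where
  "TK K \<theta> = K \<times> k_part \<theta>"

definition TTK :: "('g::real_vector \<Rightarrow> 'g) \<Rightarrow> ('g \<times> 'g) set" where
  "TTK \<theta> = k_part \<theta> \<times> k_part \<theta>"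

definition diff_K ::
  "('a, 'g::euclidean_space) lie_group_data \<Rightarrow> ('a \<Rightarrow> 'v::real_normed_vector) \<Rightarrow> 'a \<Rightarrow> 'g \<Rightarrow> 'v" where
  "diff_K G f s x = vector_derivative (\<lambda>t. f (s \<otimes>\<^bsub>G\<^esub> exp_curve G x t)) (at 0)"

definition diff_TK ::
  "('a, 'g::euclidean_space) lie_group_data \<Rightarrow> ('a \<times> 'g \<Rightarrow> real) \<Rightarrow> ('a, 'g) one_form" where
  "diff_TK G f = (\<lambda>(s, u) (x, y).
     vector_derivative (\<lambda>t. f (s \<otimes>\<^bsub>G\<^esub> exp_curve G x t, u + t *\<^sub>R y)) (at 0))"

text \<open>Exterior derivatives of one-forms, from \<open>d\<alpha>(X, Y) = X(\<alpha>(Y)) - Y(\<alpha>(X)) - \<alpha>([X, Y])\<close> with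
  vector fields \<open>X\<close>, \<open>Y\<close> that are constant in the left trivialization; for those
  \<open>[(x, y), (x', y')] = ([x, x'], 0)\<close>.\<close>

definition ext_d_K ::
  "('a, 'g::euclidean_space) lie_group_data \<Rightarrow> ('a \<Rightarrow> 'g \<Rightarrow> 'v::real_normed_vector) \<Rightarrow>
   'a \<Rightarrow> 'g \<Rightarrow> 'g \<Rightarrow> 'v" where
  "ext_d_K G \<alpha> s x y =
     diff_K G (\<lambda>r. \<alpha> r y) s x - diff_K G (\<lambda>r. \<alpha> r x) s y - \<alpha> s (bracket G x y)"

definition ext_d_TK ::
  "('a, 'g::euclidean_space) lie_group_data \<Rightarrow> ('a, 'g) one_form \<Rightarrow> ('a, 'g) two_form" where
  "ext_d_TK G \<alpha> p \<xi> \<eta> =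
     diff_TK G (\<lambda>q. \<alpha> q \<eta>) p \<xi> - diff_TK G (\<lambda>q. \<alpha> q \<xi>) p \<eta> - \<alpha> p (bracket G (fst \<xi>) (fst \<eta>), 0)"

definition wedge :: "('t \<Rightarrow> real) \<Rightarrow> ('t \<Rightarrow> real) \<Rightarrow> 't \<Rightarrow> 't \<Rightarrow> real" where
  "wedge \<alpha> \<beta> x y = \<alpha> x * \<beta> y - \<alpha> y * \<beta> x"

definition nondegenerate ::
  "'a set \<Rightarrow> ('g::real_vector \<Rightarrow> 'g) \<Rightarrow> ('a, 'g) two_form \<Rightarrow> bool" where
  "nondegenerate K \<theta> \<omega> \<longleftrightarrow>
     (\<forall>p\<in>TK K \<theta>. \<forall>\<xi>\<in>TTK \<theta>. (\<forall>\<eta>\<in>TTK \<theta>. \<omega> p \<xi> \<eta> = 0) \<longrightarrow> \<xi> = 0)"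


section \<open>The symmetry group \<open>H\<close>\<close>

definition stab :: "('a, 'g::euclidean_space) lie_group_data \<Rightarrow> 'a set \<Rightarrow> 'g \<Rightarrow> 'a set" where
  "stab G K w0 = {h \<in> K. Ad G h w0 = w0}"

text \<open>The generator on \<open>TK\<close> of the action \<open>h \<cdot> (s, u) = (h s, u)\<close>.\<close>

definition gen :: "('a, 'g::euclidean_space) lie_group_data \<Rightarrow> 'g \<Rightarrow> 'a \<times> 'g \<Rightarrow> 'g \<times> 'g" where
  "gen G Y = (\<lambda>(s, u). (Ad G (inv\<^bsub>G\<^esub> s) Y, 0))"

text \<open>In the left trivialization the tangent map of \<open>(s, u) \<mapsto> (h s, u)\<close> is the identity
  on \<open>\<kk> \<times> \<kk>\<close>, so that the pull-back of a form only moves the base point.\<close>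

definition H_invariant ::
  "('a, 'g::euclidean_space) lie_group_data \<Rightarrow> ('g \<Rightarrow> 'g) \<Rightarrow> 'a set \<Rightarrow> 'g \<Rightarrow>
   ('a, 'g) two_form \<Rightarrow> bool" where
  "H_invariant G \<theta> K w0 \<omega> \<longleftrightarrow> (\<forall>h\<in>stab G K w0. \<forall>(s, u)\<in>TK K \<theta>. \<forall>\<xi>\<in>TTK \<theta>. \<forall>\<eta>\<in>TTK \<theta>.
     \<omega> (h \<otimes>\<^bsub>G\<^esub> s, u) \<xi> \<eta> = \<omega> (s, u) \<xi> \<eta>)"

definition H_horizontal ::
  "('a, 'g::euclidean_space) lie_group_data \<Rightarrow> ('g \<Rightarrow> 'g) \<Rightarrow> 'a set \<Rightarrow> 'g \<Rightarrow>
   ('a, 'g) two_form \<Rightarrow> bool" where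
  "H_horizontal G \<theta> K w0 \<omega> \<longleftrightarrow> (\<forall>Y\<in>Lie G (stab G K w0). \<forall>p\<in>TK K \<theta>. \<forall>\<eta>\<in>TTK \<theta>.
     \<omega> p (gen G Y p) \<eta> = 0)"

text \<open>A form that is nondegenerate, or one for which the action has a momentum map with nonzero
  differential, is not horizontal unless \<open>\<hh> = 0\<close>. Below, \<open>\<Lambda>\<close> is basic, and consequently
  \<open>\<Omega>\<^sup>K + \<Lambda>\<close> is invariant and has the same momentum map as \<open>\<Omega>\<^sup>K\<close>.\<close>

definition H_basic ::
  "('a, 'g::euclidean_space) lie_group_data \<Rightarrow> ('g \<Rightarrow> 'g) \<Rightarrow> 'a set \<Rightarrow> 'g \<Rightarrow>
   ('a, 'g) two_form \<Rightarrow> bool" where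
  "H_basic G \<theta> K w0 \<omega> \<longleftrightarrow> H_invariant G \<theta> K w0 \<omega> \<and> H_horizontal G \<theta> K w0 \<omega>"


section \<open>The non-holonomic system\<close>

definition connection_form ::
  "('a, 'g::euclidean_space) lie_group_data \<Rightarrow> 'g \<Rightarrow> 'a \<Rightarrow> 'g \<Rightarrow> 'g" where
  "connection_form G w0 s u = - bracket G (Ad G s u) w0"

text \<open>\<open>\<I> + \<A>\<^sub>s\<^sup>* \<A>\<^sub>s\<close>, where \<open>\<A>\<^sub>s\<^sup>* \<A>\<^sub>s = Ad(s\<inverse>) ad(w0)\<^sup>2 Ad(s)\<close> on \<open>\<kk>\<close>.\<close>

definition metric_tensor ::
  "('a, 'g::euclidean_space) lie_group_data \<Rightarrow> 'g \<Rightarrow> ('g \<Rightarrow> 'g) \<Rightarrow> 'a \<Rightarrow> 'g \<Rightarrow> 'g" where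
  "metric_tensor G w0 \<I> s u =
     \<I> u + Ad G (inv\<^bsub>G\<^esub> s) (bracket G w0 (bracket G w0 (Ad G s u)))"

definition theta_K ::
  "('a, 'g::euclidean_space) lie_group_data \<Rightarrow> ('g \<Rightarrow> 'g) \<Rightarrow> 'g \<Rightarrow> ('g \<Rightarrow> 'g) \<Rightarrow>
   ('a, 'g) one_form" where
  "theta_K G \<theta> w0 \<I> = (\<lambda>(s, u) \<xi>. ip G \<theta> (metric_tensor G w0 \<I> s u) (fst \<xi>))"

definition Omega_K ::
  "('a, 'g::euclidean_space) lie_group_data \<Rightarrow> ('g \<Rightarrow> 'g) \<Rightarrow> 'g \<Rightarrow> ('g \<Rightarrow> 'g) \<Rightarrow>
   ('a, 'g) two_form" where
  "Omega_K G \<theta> w0 \<I> p \<xi> \<eta> = - ext_d_TK G (theta_K G \<theta> w0 \<I>) p \<xi> \<eta>"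

definition H_c ::
  "('a, 'g::euclidean_space) lie_group_data \<Rightarrow> ('g \<Rightarrow> 'g) \<Rightarrow> 'g \<Rightarrow> ('g \<Rightarrow> 'g) \<Rightarrow>
   'a \<times> 'g \<Rightarrow> real" where
  "H_c G \<theta> w0 \<I> = (\<lambda>(s, u). 1/2 * ip G \<theta> (metric_tensor G w0 \<I> s u) u)"

definition A_dA ::
  "('a, 'g::euclidean_space) lie_group_data \<Rightarrow> ('g \<Rightarrow> 'g) \<Rightarrow> 'g \<Rightarrow> ('a, 'g) two_form" where
  "A_dA G \<theta> w0 = (\<lambda>(s, u) \<xi> \<eta>. ip G \<theta> (connection_form G w0 s u)
     (ext_d_K G (connection_form G w0) s (fst \<xi>) (fst \<eta>)))"

definition X_nh ::
  "('a, 'g::euclidean_space) lie_group_data \<Rightarrow> ('g \<Rightarrow> 'g) \<Rightarrow> 'g \<Rightarrow> ('g \<Rightarrow> 'g) \<Rightarrow>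
   'a \<times> 'g \<Rightarrow> 'g \<times> 'g" where
  "X_nh G \<theta> w0 \<I> p = (THE \<xi>. \<xi> \<in> TTK \<theta> \<and> (\<forall>\<eta>\<in>TTK \<theta>.
     Omega_K G \<theta> w0 \<I> p \<xi> \<eta> + A_dA G \<theta> w0 p \<xi> \<eta> = diff_TK G (H_c G \<theta> w0 \<I>) p \<eta>))"

text \<open>\<open>J_H \<dots> Y p\<close> is the pairing of the momentum map at \<open>p\<close> with \<open>Y\<close>.\<close>

definition J_H ::
  "('a, 'g::euclidean_space) lie_group_data \<Rightarrow> ('g \<Rightarrow> 'g) \<Rightarrow> 'g \<Rightarrow> ('g \<Rightarrow> 'g) \<Rightarrow>
   'g \<Rightarrow> 'a \<times> 'g \<Rightarrow> real" where
  "J_H G \<theta> w0 \<I> Y = (\<lambda>(s, u). ip G \<theta> (metric_tensor G w0 \<I> s u) (Ad G (inv\<^bsub>G\<^esub> s) Y))"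


section \<open>The form \<open>\<Lambda>\<close>\<close>

text \<open>The structure constant \<open>\<langle>x, [y, z]\<rangle>\<close> of three basis vectors.\<close>

definition struct_const ::
  "('a, 'g::euclidean_space) lie_group_data \<Rightarrow> ('g \<Rightarrow> 'g) \<Rightarrow> 'g \<Rightarrow> 'g \<Rightarrow> 'g \<Rightarrow> real" where
  "struct_const G \<theta> x y z = ip G \<theta> x (bracket G y z)"

text \<open>For \<open>b = Y\<^sub>\<alpha>\<close> this is the function \<open>l\<^sub>\<alpha>\<close>, for \<open>b = Z (\<lambda>, a)\<close> it is \<open>g\<^bsub>(\<lambda>, a)\<^esub>\<close>.\<close>

definition coord_fun ::
  "('a, 'g::euclidean_space) lie_group_data \<Rightarrow> ('g \<Rightarrow> 'g) \<Rightarrow> 'g \<Rightarrow> 'a \<times> 'g \<Rightarrow> real" where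
  "coord_fun G \<theta> b = (\<lambda>(s, u). ip G \<theta> b (Ad G s u))"

text \<open>For \<open>b = Z (\<lambda>, a)\<close> this is (the pull-back to \<open>TK\<close> of) \<open>\<eta>\<^bsup>(\<lambda>, a)\<^esup>\<close>.\<close>

definition coord_form ::
  "('a, 'g::euclidean_space) lie_group_data \<Rightarrow> ('g \<Rightarrow> 'g) \<Rightarrow> 'g \<Rightarrow> ('a, 'g) one_form" where
  "coord_form G \<theta> b = (\<lambda>(s, u) \<xi>. ip G \<theta> b (Ad G s (fst \<xi>)))"

definition Lambda ::
  "('a, 'g::euclidean_space) lie_group_data \<Rightarrow> ('g \<Rightarrow> 'g) \<Rightarrow> 'g set \<Rightarrow> 'g \<Rightarrow> ('g \<Rightarrow> real) set \<Rightarrow>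
   (nat \<Rightarrow> 'g) \<Rightarrow> (('g \<Rightarrow> real) \<times> nat \<Rightarrow> 'g) \<Rightarrow> ('a, 'g) two_form" where
  "Lambda G \<theta> \<aa> w0 P Y Z p \<xi> \<eta> =
     (let c = struct_const G \<theta>; l = coord_fun G \<theta>; \<epsilon> = coord_form G \<theta>;
          m = dim (m_part (bracket G) \<theta> \<aa>);
          N = (\<lambda>\<rho>. {1..dim (root_space (bracket G) \<aa> \<rho>)});
          \<Phi> = {\<rho>\<in>P. \<rho> w0 \<noteq> 0}
      in - 1/2 * (\<Sum>\<rho>\<in>P. \<Sum>a\<in>N \<rho>. \<Sum>b\<in>N \<rho>. \<Sum>\<alpha>\<in>{1..m}.
             (\<rho> w0)\<^sup>2 * c (Y \<alpha>) (Z (\<rho>, a)) (Z (\<rho>, b)) * l (Y \<alpha>) p *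
             wedge (\<epsilon> (Z (\<rho>, a)) p) (\<epsilon> (Z (\<rho>, b)) p) \<xi> \<eta>)
         - 1/2 * (\<Sum>\<rho>\<in>P - \<Phi>. \<Sum>\<mu>\<in>\<Phi>. \<Sum>\<nu>\<in>\<Phi>. \<Sum>a\<in>N \<rho>. \<Sum>b\<in>N \<mu>. \<Sum>d\<in>N \<nu>.
             (\<mu> w0)\<^sup>2 * c (Z (\<rho>, a)) (Z (\<mu>, b)) (Z (\<nu>, d)) * l (Z (\<rho>, a)) p *
             wedge (\<epsilon> (Z (\<mu>, b)) p) (\<epsilon> (Z (\<nu>, d)) p) \<xi> \<eta>)
         + 1/2 * (\<Sum>\<rho>\<in>P. \<Sum>\<mu>\<in>\<Phi>. \<Sum>\<nu>\<in>\<Phi>. \<Sum>a\<in>N \<rho>. \<Sum>b\<in>N \<mu>. \<Sum>d\<in>N \<nu>.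
             (\<rho> w0)\<^sup>2 * c (Z (\<rho>, a)) (Z (\<mu>, b)) (Z (\<nu>, d)) * l (Z (\<rho>, a)) p *
             wedge (\<epsilon> (Z (\<mu>, b)) p) (\<epsilon> (Z (\<nu>, d)) p) \<xi> \<eta>))"

definition Omega_tilde ::
  "('a, 'g::euclidean_space) lie_group_data \<Rightarrow> ('g \<Rightarrow> 'g) \<Rightarrow> 'g set \<Rightarrow> 'g \<Rightarrow> ('g \<Rightarrow> 'g) \<Rightarrow>
   ('g \<Rightarrow> real) set \<Rightarrow> (nat \<Rightarrow> 'g) \<Rightarrow> (('g \<Rightarrow> real) \<times> nat \<Rightarrow> 'g) \<Rightarrow> ('a, 'g) two_form" where
  "Omega_tilde G \<theta> \<aa> w0 \<I> P Y Z p \<xi> \<eta> =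
     Omega_K G \<theta> w0 \<I> p \<xi> \<eta> + Lambda G \<theta> \<aa> w0 P Y Z p \<xi> \<eta>"

end

theory Submission
  imports Defs
begin

text \<open>
  Write \<open>U = Ad(s) u\<close>, \<open>X = Ad(s) x\<close>, \<open>X' = Ad(s) x'\<close> and \<open>D = ad(w0)\<^sup>2\<close>. The subalgebra \<open>\<hh>\<close> is the kernel
  of \<open>D\<close> on \<open>\<kk>\<close>, and elements of \<open>\<hh>\<close> commute with \<open>D\<close>. With the components along \<open>\<hh>\<close> and its orthogonal
  complement, the sums over roots collapse to
  \<open>\<Lambda> = \<langle>D U, [X\<^sub>\<bottom>, X'\<^sub>\<bottom>]\<rangle> - \<langle>U\<^sub>\<hh>, [D X, X']\<rangle>\<close>; the cross terms in the \<open>\<mm>\<close>-part vanish since distinct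
  positive roots have distinct squares. This expression is visibly basic, and on \<open>X = U\<close> it equals
  \<open>\<langle>D U, [U, X']\<rangle> = \<langle>\<A>, d\<A>\<rangle>\<close>. The equation for \<open>X\<^sub>n\<^sub>h\<close> forces its first component to be \<open>u\<close>, so
  \<open>\<Lambda>\<close> may replace \<open>\<langle>\<A>, d\<A>\<rangle>\<close> there.

  The derivatives along \<open>s exp(t x)\<close> only use that \<open>exp(t x)\<close> is some one-parameter subgroup with
  velocity \<open>x\<close>, which exists for \<open>x \<in> \<kk>\<close> because \<open>\<kk>\<close> is the Lie algebra of \<open>K\<close>.
\<close>

section \<open>Lie algebras with a Cartan involution\<close>

text \<open>The collapse of \<Lambda> rests on one symmetry. If \<open>h\<close> in \<kk> commutes
  with \<open>w\<close> in \<aa>, then ad(w)^2 may be moved from one slot to the other in the skew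
  form that sends \<open>x\<close>, \<open>y\<close> to the inner product of \<open>h\<close> with
  [x, y]. At \<open>w0\<close> this makes the two halves of a wedge agree in the sums over \<mm> and
  over the roots vanishing at \<open>w0\<close>. For \<open>h\<close> in \<mm> it holds at every
  \<open>w\<close> in \<aa>, and comparing eigenvalues kills the cross terms of roots whose squares
  differ at some \<open>w\<close>, even if they agree at \<open>w0\<close>. Nondegeneracy is
  insensitive to \<Lambda>: the fibres of TK are isotropic and are paired with the base by the
  positive metric tensor, and a form that sees base components only cannot spoil this. On the group
  side the bracket is a second derivative of the multiplication, while smoothness supplies
  differentiability of directional derivatives along fixed vectors only. Wherever such a vector
  moves, it has to be expanded in a basis.\<close>

lemma lin_trace_comp_commute:
  fixes f g :: "'g::euclidean_space \<Rightarrow> 'g"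
  assumes "linear f" "linear g"
  shows "lin_trace (\<lambda>z. f (g z)) = lin_trace (\<lambda>z. g (f z))"
proof -
  have *: "inner (f (g b)) b = (\<Sum>c\<in>Basis. inner (g b) c * inner (f c) b)"
    if "linear f" for f g :: "'g \<Rightarrow> 'g" and b
  proof -
    have "f (g b) = f (\<Sum>c\<in>Basis. inner (g b) c *\<^sub>R c)"
      by (simp add: euclidean_representation)
    also have "\<dots> = (\<Sum>c\<in>Basis. inner (g b) c *\<^sub>R f c)"
      using that by (simp add: linear_sum linear_scale)
    finally show ?thesis by (simp add: inner_sum_left)
  qed
  show ?thesis
    unfolding lin_trace_def *[OF assms(1), of g] *[OF assms(2), of f]
    by (subst sum.swap) (simp add: mult.commute)
qed

lemma lin_trace_add: "lin_trace (\<lambda>z. f z + g z) = lin_trace f + lin_trace g"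
  and lin_trace_diff: "lin_trace (\<lambda>z. f z - g z) = lin_trace f - lin_trace g"
  and lin_trace_scale: "lin_trace (\<lambda>z. c *\<^sub>R f z) = c * lin_trace f"
  and lin_trace_zero: "lin_trace (\<lambda>z. 0) = 0"
  by (simp_all add: lin_trace_def inner_add_left inner_diff_left sum.distrib sum_subtractf
      sum_distrib_left)

locale cartan_lie_algebra =
  fixes br :: "'g::euclidean_space \<Rightarrow> 'g \<Rightarrow> 'g" and \<theta> :: "'g \<Rightarrow> 'g"
  assumes bilinear_br: "bilinear br"
    and leibniz: "br x (br y z) = br (br x y) z + br y (br x z)"
    and linear_theta: "linear \<theta>"
    and theta_theta [simp]: "\<theta> (\<theta> x) = x"
    and theta_br: "\<theta> (br x y) = br (\<theta> x) (\<theta> y)"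
    and killing_theta_neg: "x \<noteq> 0 \<Longrightarrow> - killing br x (\<theta> x) > 0"
begin

abbreviation "kk \<equiv> k_part \<theta>"
abbreviation "pp \<equiv> p_part \<theta>"

definition iprod :: "'g \<Rightarrow> 'g \<Rightarrow> real" where "iprod x y = - killing br x (\<theta> y)"

lemma linear_br_right: "linear (br x)"
  using bilinear_br by (simp add: bilinear_def)

lemma linear_br_left: "linear (\<lambda>x. br x y)"
  using bilinear_br by (simp add: bilinear_def)

lemmas br_simps =
  linear_add[OF linear_br_right] linear_diff[OF linear_br_right] linear_neg[OF linear_br_right]
  linear_scale[OF linear_br_right] linear_0[OF linear_br_right]
  linear_add[OF linear_br_left] linear_diff[OF linear_br_left] linear_neg[OF linear_br_left]
  linear_scale[OF linear_br_left] linear_0[OF linear_br_left]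

lemmas theta_simps =
  linear_add[OF linear_theta] linear_diff[OF linear_theta] linear_neg[OF linear_theta]
  linear_scale[OF linear_theta] linear_0[OF linear_theta]

section \<open>Invariance of the Killing form and the inner product\<close>

lemma bilinear_killing: "bilinear (killing br)"
  unfolding bilinear_def killing_def
  by (intro conjI allI linearI) (simp_all add: br_simps lin_trace_add lin_trace_scale)

lemma linear_killing_right: "linear (killing br x)"
  using bilinear_killing by (simp add: bilinear_def)

lemma linear_killing_left: "linear (\<lambda>x. killing br x y)"
  using bilinear_killing by (simp add: bilinear_def)

lemmas killing_simps =
  linear_add[OF linear_killing_right] linear_diff[OF linear_killing_right]
  linear_neg[OF linear_killing_right] linear_scale[OF linear_killing_right]
  linear_0[OF linear_killing_right]
  linear_add[OF linear_killing_left] linear_diff[OF linear_killing_left]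
  linear_neg[OF linear_killing_left] linear_scale[OF linear_killing_left]
  linear_0[OF linear_killing_left]

lemma killing_commute: "killing br x y = killing br y x"
  unfolding killing_def using lin_trace_comp_commute[OF linear_br_right linear_br_right] .

lemma br_br: "br (br x y) z = br x (br y z) - br y (br x z)"
  using leibniz[of x y z] by simp

text \<open>As ad [x, y] is a commutator, both sides contain the trace of ad(x) ad(y) ad(z); the
  remaining traces agree by cyclicity.\<close>

lemma killing_br: "killing br (br x y) z = killing br x (br y z)"
proof -
  have "linear (\<lambda>v. br x (br z v))"
    using linear_compose[OF linear_br_right[of z] linear_br_right[of x]] by (simp add: o_def)
  from lin_trace_comp_commute[OF linear_br_right this, of y] show ?thesis
    unfolding killing_def by (simp add: br_br br_simps lin_trace_diff)
qed

text \<open>An automorphism conjugates ad, and conjugation does not change a trace. This serves for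
  \<theta> as well as for Ad(s).\<close>

lemma killing_automorphism:
  assumes "linear \<phi>" "linear \<psi>" "\<And>x. \<phi> (\<psi> x) = x" "\<And>x. \<psi> (\<phi> x) = x"
    and "\<And>x y. \<phi> (br x y) = br (\<phi> x) (\<phi> y)"
  shows "killing br (\<phi> x) (\<phi> y) = killing br x y"
proof -
  have "br (\<phi> x) (br (\<phi> y) z) = \<phi> (br x (br y (\<psi> z)))" for z
    by (simp add: assms)
  moreover have "linear (\<lambda>z. br x (br y (\<psi> z)))"
    using linear_compose[OF linear_compose[OF assms(2) linear_br_right] linear_br_right]
    by (simp add: o_def)
  ultimately show ?thesis
    unfolding killing_def using lin_trace_comp_commute[OF assms(1), of "\<lambda>z. br x (br y (\<psi> z))"]
    by (simp add: assms)
qed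

lemma killing_theta: "killing br (\<theta> x) (\<theta> y) = killing br x y"
  by (rule killing_automorphism[OF linear_theta linear_theta]) (simp_all add: theta_br)

text \<open>By the Leibniz rule \<open>ad [x, x] = 0\<close>, and the Killing form is nondegenerate.\<close>

lemma br_self [simp]: "br x x = 0"
proof (rule ccontr)
  assume "br x x \<noteq> 0"
  moreover have "killing br (br x x) y = 0" for y
    by (simp add: killing_def br_br lin_trace_zero)
  ultimately show False using killing_theta_neg[of "br x x"] by simp
qed

lemma br_commute: "br x y = - br y x"
proof -
  have "br (x + y) (x + y) = br x y + br y x"
    unfolding br_simps by (simp only: br_self) simp
  then show ?thesis by (simp add: add_eq_0_iff2 minus_equation_iff)
qed

lemma iprod_commute: "iprod x y = iprod y x"
  unfolding iprod_def using killing_theta[of x "\<theta> y"] killing_commute by simp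

lemma iprod_pos: "x \<noteq> 0 \<Longrightarrow> iprod x x > 0"
  using killing_theta_neg by (simp add: iprod_def)

lemma linear_iprod_right: "linear (iprod x)"
  unfolding iprod_def by (intro linearI) (simp_all add: theta_simps killing_simps)

lemma linear_iprod_left: "linear (\<lambda>x. iprod x y)"
  unfolding iprod_def by (intro linearI) (simp_all add: theta_simps killing_simps)

lemmas iprod_simps =
  linear_add[OF linear_iprod_right] linear_diff[OF linear_iprod_right] linear_neg[OF linear_iprod_right]
  linear_scale[OF linear_iprod_right] linear_0[OF linear_iprod_right]
  linear_add[OF linear_iprod_left] linear_diff[OF linear_iprod_left] linear_neg[OF linear_iprod_left]
  linear_scale[OF linear_iprod_left] linear_0[OF linear_iprod_left]

lemma subspace_k: "subspace kk" and subspace_p: "subspace pp"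
  by (auto simp: subspace_def k_part_def p_part_def theta_simps)

lemma br_k_k: "x \<in> kk \<Longrightarrow> y \<in> kk \<Longrightarrow> br x y \<in> kk"
  and br_p_k: "x \<in> pp \<Longrightarrow> y \<in> kk \<Longrightarrow> br x y \<in> pp"
  and br_p_p: "x \<in> pp \<Longrightarrow> y \<in> pp \<Longrightarrow> br x y \<in> kk"
  by (simp_all add: k_part_def p_part_def theta_br br_simps)

lemma iprod_k: "y \<in> kk \<Longrightarrow> iprod x y = - killing br x y"
  by (simp add: iprod_def k_part_def)

text \<open>For \<open>y\<close> in \<kk> the map ad(y) is skew; its sign is absorbed by writing
  [x, y] instead of [y, x] on the left.\<close>

lemma iprod_br_k: "y \<in> kk \<Longrightarrow> iprod (br x y) z = iprod x (br y z)"
  by (simp add: iprod_def theta_br killing_br k_part_def)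

text \<open>Here \<theta> changes the sign of \<open>w\<close>, so that ad(w) is self-adjoint
  instead of skew.\<close>

lemma iprod_br_p: "w \<in> pp \<Longrightarrow> iprod (br w x) y = iprod x (br w y)"
  using killing_br[of w x "\<theta> y"] killing_commute br_commute[of x w] killing_br[of x w "\<theta> y"]
  by (simp add: iprod_def theta_br p_part_def killing_simps br_simps)

lemma iprod_ad_sq: "w \<in> pp \<Longrightarrow> iprod (br w (br w x)) y = iprod x (br w (br w y))"
  by (simp add: iprod_br_p)

lemma ad_sq_k: "w \<in> pp \<Longrightarrow> x \<in> kk \<Longrightarrow> br w (br w x) \<in> kk"
  using br_p_k br_p_p by blast

lemma iprod_eqI: "x \<in> kk \<Longrightarrow> y \<in> kk \<Longrightarrow> (\<And>z. z \<in> kk \<Longrightarrow> iprod x z = iprod y z) \<Longrightarrow> x = y"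
  using iprod_pos[of "x - y"] subspace_diff[OF subspace_k, of x y]
  by (auto simp: iprod_simps)

lemma br_fixes:
  assumes "br w h = 0"
  shows "br w (br h x) = br h (br w x)"
  using leibniz[of w h x] assms by (simp add: br_simps)

text \<open>Maps such as the metric tensor are controlled on \<kk> only. Extended by the identity on
  \<pp>, such a map becomes an injective linear map of the whole space, where injectivity implies
  surjectivity.\<close>

lemma k_endomorphism_surj:
  assumes "\<And>x. x \<in> kk \<Longrightarrow> T x \<in> kk"
    and "\<And>x y. x \<in> kk \<Longrightarrow> y \<in> kk \<Longrightarrow> T (x + y) = T x + T y"
    and "\<And>c x. x \<in> kk \<Longrightarrow> T (c *\<^sub>R x) = c *\<^sub>R T x"
    and inj: "\<And>x. x \<in> kk \<Longrightarrow> T x = 0 \<Longrightarrow> x = 0"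
    and "r \<in> kk"
  shows "\<exists>y\<in>kk. T y = r"
proof -
  \<comment> \<open>The projections onto the two eigenspaces of \<theta>.\<close>
  define \<kappa> where "\<kappa> x = (1/2) *\<^sub>R (x + \<theta> x)" for x
  define \<pi> where "\<pi> x = (1/2) *\<^sub>R (x - \<theta> x)" for x
  have \<kappa>: "\<kappa> x \<in> kk" and \<pi>: "\<pi> x \<in> pp" for x
    by (simp_all add: \<kappa>_def \<pi>_def k_part_def p_part_def theta_simps add.commute algebra_simps)
  have split: "x = \<kappa> x + \<pi> x" for x
    by (simp add: \<kappa>_def \<pi>_def scaleR_add_right scaleR_diff_right flip: scaleR_add_left)
  have direct: "a = a'" "b = b'" if "a + b = a' + b'" "a \<in> kk" "a' \<in> kk" "b \<in> pp" "b' \<in> pp" for a a' b b'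
  proof -
    have "a - a' = b' - b" using that(1) by (simp add: algebra_simps)
    moreover have "\<theta> (a - a') = a - a'" "\<theta> (b' - b) = - (b' - b)"
      using that by (simp_all add: k_part_def p_part_def theta_simps)
    ultimately have "(a - a') + (a - a') = 0" by (metis add.right_inverse)
    then have "2 *\<^sub>R (a - a') = 0" by (simp only: scaleR_2)
    then show "a = a'" by simp
    with that(1) show "b = b'" by simp
  qed
  define \<Phi> where "\<Phi> x = T (\<kappa> x) + \<pi> x" for x
  have lin: "\<kappa> (x + y) = \<kappa> x + \<kappa> y" "\<pi> (x + y) = \<pi> x + \<pi> y"
    "\<kappa> (c *\<^sub>R x) = c *\<^sub>R \<kappa> x" "\<pi> (c *\<^sub>R x) = c *\<^sub>R \<pi> x" for x y c
    by (simp_all add: \<kappa>_def \<pi>_def theta_simps algebra_simps)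
  have "linear \<Phi>"
    unfolding \<Phi>_def
    by (intro linearI) (simp_all add: lin assms(2,3) \<kappa> algebra_simps)
  moreover have "inj \<Phi>"
  proof (subst linear_injective_0[OF \<open>linear \<Phi>\<close>], intro allI impI)
    fix x assume "\<Phi> x = 0"
    then have "T (\<kappa> x) + \<pi> x = 0 + 0" by (simp add: \<Phi>_def)
    then have "T (\<kappa> x) = 0" "\<pi> x = 0"
      using direct[of "T (\<kappa> x)" "\<pi> x" 0 0] assms(1) \<kappa> \<pi> subspace_0[OF subspace_k] subspace_0[OF subspace_p]
      by auto
    with inj[OF \<kappa>] have "\<kappa> x = 0" by blast
    then show "x = 0" using \<open>\<pi> x = 0\<close> split by (metis add_0)
  qed
  ultimately have "surj \<Phi>" using linear_injective_imp_surjective by blast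
  then obtain x where "T (\<kappa> x) + \<pi> x = r + 0" by (metis \<Phi>_def add_0_right surjD)
  then have "T (\<kappa> x) = r"
    using direct[of "T (\<kappa> x)" "\<pi> x" r 0] assms(1,5) \<kappa> \<pi> subspace_0[OF subspace_p] by blast
  then show ?thesis using \<kappa> by blast
qed

text \<open>The left side is the product of [h, ad(w)^2 x] with \<open>y\<close>; now ad(h) commutes
  with ad(w)^2, and the latter is self-adjoint.\<close>

lemma iprod_br_h:
  assumes "w \<in> pp" "h \<in> kk" "br w h = 0" "x \<in> kk" "y \<in> kk"
  shows "iprod h (br (br w (br w x)) y) = iprod h (br x (br w (br w y)))"
proof -
  have "iprod h (br (br w (br w x)) y) = iprod (br h (br w (br w x))) y"
    using assms by (simp add: iprod_br_k ad_sq_k)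
  also have "\<dots> = iprod (br w (br w (br h x))) y"
    using assms by (simp add: br_fixes)
  also have "\<dots> = iprod (br h x) (br w (br w y))"
    using assms by (simp add: iprod_ad_sq)
  finally show ?thesis
    using assms by (simp add: iprod_br_k)
qed

section \<open>Sums of structure constants as trilinear expressions\<close>

lemma iprod_sum_left: "iprod (\<Sum>i\<in>A. r i *\<^sub>R g i) y = (\<Sum>i\<in>A. r i * iprod (g i) y)"
  using linear_sum[OF linear_iprod_left, of "\<lambda>i. r i *\<^sub>R g i" A y] by (simp add: iprod_simps)

lemma iprod_br_sum_left:
  "iprod z (br (\<Sum>j\<in>B. p j *\<^sub>R h j) y) = (\<Sum>j\<in>B. p j * iprod z (br (h j) y))"
  using linear_sum[OF linear_br_left, of "\<lambda>j. p j *\<^sub>R h j" B y]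
  by (simp add: br_simps linear_sum[OF linear_iprod_right] iprod_simps)

lemma iprod_br_sum_right:
  "iprod z (br x (\<Sum>k\<in>C. q k *\<^sub>R l k)) = (\<Sum>k\<in>C. q k * iprod z (br x (l k)))"
  using linear_sum[OF linear_br_right, of x "\<lambda>k. q k *\<^sub>R l k" C]
  by (simp add: br_simps linear_sum[OF linear_iprod_right] iprod_simps)

lemma iprod_br_sums:
  "iprod (\<Sum>i\<in>A. r i *\<^sub>R g i) (br (\<Sum>j\<in>B. p j *\<^sub>R h j) (\<Sum>k\<in>C. q k *\<^sub>R l k)) =
   (\<Sum>i\<in>A. \<Sum>j\<in>B. \<Sum>k\<in>C. r i * (p j * (q k * iprod (g i) (br (h j) (l k)))))"
  unfolding iprod_sum_left[of r g A]
  unfolding iprod_br_sum_left[of _ p h B]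
  by (simp only: iprod_br_sum_right sum_distrib_left)

lemma iprod_br_sums_scaled:
  "(\<Sum>i\<in>A. \<Sum>j\<in>B. \<Sum>k\<in>C. p j * iprod (g i) (br (h j) (l k))) =
   iprod (\<Sum>i\<in>A. g i) (br (\<Sum>j\<in>B. p j *\<^sub>R h j) (\<Sum>k\<in>C. l k))"
  using iprod_br_sums[of "\<lambda>_. 1" g A p h B "\<lambda>_. 1" l C] by simp

text \<open>The pattern of the inner sums in \<open>Lambda\<close>: the structure constants
  reassemble to a trilinear expression, and the wedge becomes a difference with \<open>x\<close> and
  \<open>y\<close> exchanged. The factor \<open>c\<close> carries the eigenvalue, which is constant
  in the inner sums.\<close>

lemma iprod_br_wedge_sums:
  "(\<Sum>i\<in>A. \<Sum>j\<in>B. \<Sum>k\<in>C. c * iprod (g i) (br (h j) (l k)) * iprod (g i) u *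
      (iprod (h j) x * iprod (l k) y - iprod (h j) y * iprod (l k) x)) =
   c * (iprod (\<Sum>i\<in>A. iprod (g i) u *\<^sub>R g i)
          (br (\<Sum>j\<in>B. iprod (h j) x *\<^sub>R h j) (\<Sum>k\<in>C. iprod (l k) y *\<^sub>R l k))
      - iprod (\<Sum>i\<in>A. iprod (g i) u *\<^sub>R g i)
          (br (\<Sum>j\<in>B. iprod (h j) y *\<^sub>R h j) (\<Sum>k\<in>C. iprod (l k) x *\<^sub>R l k)))"
  unfolding iprod_br_sums sum_subtractf[symmetric] sum_distrib_left
  by (intro sum.cong refl) (simp add: algebra_simps)

lemma orthonormal_basis_expansion:
  assumes "orthonormal_basis iprod W I b" "finite I" "x \<in> W"
  shows "x = (\<Sum>i\<in>I. iprod (b i) x *\<^sub>R b i)"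
proof -
  have "x \<in> span (b ` I)" using assms by (simp add: orthonormal_basis_def)
  then show ?thesis
  proof (induction rule: span_induct_alt)
    case base
    show ?case by (simp add: iprod_simps)
  next
    case (step c v y)
    from step(1) obtain j where j: "j \<in> I" "v = b j" by auto
    have "(\<Sum>i\<in>I. iprod (b i) (b j) *\<^sub>R b i) = (\<Sum>i\<in>I. if i = j then b i else 0)"
      using assms(1) j by (intro sum.cong) (auto simp: orthonormal_basis_def)
    also have "\<dots> = b j" using j assms(2) by simp
    finally show ?case
      using step(2) j by (simp add: iprod_simps scaleR_add_left sum.distrib flip: scaleR_scaleR scaleR_sum_right)
  qed
qed

end

section \<open>The form \<open>\<Lambda>\<close> in terms of the decomposition of \<open>\<kk>\<close>\<close>

text \<open>Applying ad(w) twice leads from \<open>Z\<close> through \<open>e\<close> back to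
  \<open>Z\<close>, which eliminates \<open>e\<close>. The eigenvalue equation is kept for all
  \<open>w\<close> in \<aa>, because \<open>w0\<close> alone need not separate the roots.\<close>

locale root_basis = cartan_lie_algebra br \<theta> for br :: "'g::euclidean_space \<Rightarrow> 'g \<Rightarrow> 'g" and \<theta> +
  fixes \<aa> :: "'g set" and P :: "('g \<Rightarrow> real) set" and Y :: "nat \<Rightarrow> 'g"
    and Z :: "('g \<Rightarrow> real) \<times> nat \<Rightarrow> 'g" and w0 :: 'g
  assumes a_subset: "\<aa> \<subseteq> p_part \<theta>" and subspace_a: "subspace \<aa>" and w0: "w0 \<in> \<aa>"
    and positive: "positive_roots br \<aa> P"
    and basis_Y: "orthonormal_basis iprod (m_part br \<theta> \<aa>) {1..dim (m_part br \<theta> \<aa>)} Y"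
    and basis_Z: "orthonormal_basis iprod (ortho iprod (m_part br \<theta> \<aa>) \<inter> k_part \<theta>) (root_indices br \<aa> P) Z"
    and Z_eigen: "w \<in> \<aa> \<Longrightarrow> (\<rho>, a) \<in> root_indices br \<aa> P \<Longrightarrow>
      br w (br w (Z (\<rho>, a))) = (\<rho> w)\<^sup>2 *\<^sub>R Z (\<rho>, a)"
begin

abbreviation "mm \<equiv> m_part br \<theta> \<aa>"
abbreviation "N \<rho> \<equiv> {1..dim (root_space br \<aa> \<rho>)}"
abbreviation "\<Phi> \<equiv> {\<rho>\<in>P. \<rho> w0 \<noteq> 0}"

definition D :: "'g \<Rightarrow> 'g" where "D x = br w0 (br w0 x)"

definition m_comp :: "'g \<Rightarrow> 'g" where "m_comp x = (\<Sum>\<alpha>\<in>{1..dim mm}. iprod (Y \<alpha>) x *\<^sub>R Y \<alpha>)"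

definition root_comp :: "('g \<Rightarrow> real) \<Rightarrow> 'g \<Rightarrow> 'g" where
  "root_comp \<rho> x = (\<Sum>a\<in>N \<rho>. iprod (Z (\<rho>, a)) x *\<^sub>R Z (\<rho>, a))"

text \<open>On \<kk>, this and \<open>perp_comp\<close> are the orthogonal projections onto the
  kernel of ad(w0) and onto its complement; \<open>h_comp_unique\<close> frees them from the
  bases.\<close>

definition h_comp :: "'g \<Rightarrow> 'g" where
  "h_comp x = m_comp x + (\<Sum>\<rho>\<in>P - \<Phi>. root_comp \<rho> x)"

definition perp_comp :: "'g \<Rightarrow> 'g" where "perp_comp x = (\<Sum>\<rho>\<in>\<Phi>. root_comp \<rho> x)"

lemma w0_p: "w0 \<in> pp" using w0 a_subset by auto

lemma linear_D: "linear D"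
  unfolding D_def by (intro linearI) (simp_all add: br_simps)

lemmas D_simps =
  linear_add[OF linear_D] linear_diff[OF linear_D] linear_neg[OF linear_D]
  linear_scale[OF linear_D] linear_0[OF linear_D] linear_sum[OF linear_D]

lemma D_k: "x \<in> kk \<Longrightarrow> D x \<in> kk"
  unfolding D_def by (rule ad_sq_k[OF w0_p])

lemma iprod_D: "iprod (D x) y = iprod x (D y)"
  unfolding D_def by (rule iprod_ad_sq[OF w0_p])

lemma iprod_D_br: "iprod (D x) y = iprod (br w0 x) (br w0 y)"
  unfolding D_def by (simp add: iprod_br_p[OF w0_p, of "br w0 x"] iprod_br_p[OF w0_p])

text \<open>Since ad(w0) is self-adjoint, the inner product of \<open>D x\<close> with
  \<open>x\<close> is the squared norm of [w0, x].\<close>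

lemma D_eq_0: "D x = 0 \<longleftrightarrow> br w0 x = 0"
proof
  assume "D x = 0"
  then have "iprod (br w0 x) (br w0 x) = 0" by (simp add: iprod_simps flip: iprod_D_br)
  then show "br w0 x = 0" using iprod_pos[of "br w0 x"] by force
qed (simp add: D_def br_simps)

lemma D_br_h: "br w0 h = 0 \<Longrightarrow> D (br h x) = br h (D x)"
  by (simp add: D_def br_fixes)

section \<open>Finiteness of the root data and the decomposition of \<kk>\<close>

lemma inj_Z: "inj_on Z (root_indices br \<aa> P)"
proof (rule inj_onI)
  fix i j assume *: "i \<in> root_indices br \<aa> P" "j \<in> root_indices br \<aa> P" "Z i = Z j"
  then have "iprod (Z i) (Z j) = 1" using basis_Z by (metis orthonormal_basis_def)
  then show "i = j" using basis_Z * by (metis orthonormal_basis_def zero_neq_one)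
qed

text \<open>\<open>orthonormal_basis\<close> does not bound its index set, and a sum over an
  infinite set would be 0. Orthonormal vectors are independent, hence finite in number.\<close>

lemma finite_root_indices: "finite (root_indices br \<aa> P)"
proof -
  have "independent (Z ` root_indices br \<aa> P)"
    unfolding independent_explicit_module
  proof (intro allI impI)
    fix T u v
    assume T: "finite T" "T \<subseteq> Z ` root_indices br \<aa> P" "(\<Sum>v\<in>T. u v *\<^sub>R v) = 0" "v \<in> T"
    have "iprod v x = (if v = x then 1 else 0)" if "x \<in> T" for x
      using basis_Z T(2,4) that unfolding orthonormal_basis_def
      by (smt (verit, ccfv_threshold) imageE subsetD)
    then have "iprod v (\<Sum>x\<in>T. u x *\<^sub>R x) = (\<Sum>x\<in>T. if v = x then u x else 0)"
      by (subst linear_sum[OF linear_iprod_right]) (auto simp: iprod_simps intro!: sum.cong)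
    with T show "u v = 0" by (simp add: iprod_simps)
  qed
  then show ?thesis
    using independent_imp_finite finite_imageD inj_Z by blast
qed

text \<open>Every root has a nonzero root space and therefore contributes at least the index
  \<open>(\<rho>, 1)\<close>.\<close>

lemma finite_P: "finite P"
proof -
  have "P \<subseteq> fst ` root_indices br \<aa> P"
  proof
    fix \<rho> assume \<rho>: "\<rho> \<in> P"
    then have "root_space br \<aa> \<rho> \<noteq> {0}"
      using positive by (auto simp: positive_roots_def restricted_roots_def)
    moreover have "0 \<in> root_space br \<aa> \<rho>" by (simp add: root_space_def br_simps)
    ultimately have "dim (root_space br \<aa> \<rho>) \<noteq> 0" by (auto simp: dim_eq_0)
    then have "1 \<le> dim (root_space br \<aa> \<rho>)" by linarith
    then have "(\<rho>, 1) \<in> root_indices br \<aa> P"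
      unfolding root_indices_def using \<rho> by (intro SigmaI) simp_all
    then show "\<rho> \<in> fst ` root_indices br \<aa> P" by force
  qed
  then show ?thesis using finite_root_indices by (meson finite_imageI finite_subset)
qed

lemma Y_m: "\<alpha> \<in> {1..dim mm} \<Longrightarrow> Y \<alpha> \<in> mm"
  using basis_Y unfolding orthonormal_basis_def by (metis image_eqI span_base)

lemma Z_mem: "i \<in> root_indices br \<aa> P \<Longrightarrow> Z i \<in> ortho iprod mm \<inter> kk"
  using basis_Z unfolding orthonormal_basis_def by (metis image_eqI span_base)

lemma m_k: "x \<in> mm \<Longrightarrow> x \<in> kk"
  by (simp add: m_part_def)

lemma m_comm: "x \<in> mm \<Longrightarrow> w \<in> \<aa> \<Longrightarrow> br w x = 0"
  using br_commute[of w x] by (simp add: m_part_def)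

lemma subspace_m: "subspace mm"
  using subspace_k by (auto simp: subspace_def m_part_def br_simps)

lemma m_comp_m: "m_comp x \<in> mm"
  unfolding m_comp_def by (intro subspace_sum subspace_m subspace_scale Y_m)

lemma root_comp_k: "\<rho> \<in> P \<Longrightarrow> root_comp \<rho> x \<in> kk"
  unfolding root_comp_def using Z_mem
  by (intro subspace_sum subspace_k subspace_scale) (auto simp: root_indices_def)

lemma root_comp_eigen: "\<rho> \<in> P \<Longrightarrow> w \<in> \<aa> \<Longrightarrow>
    br w (br w (root_comp \<rho> x)) = (\<rho> w)\<^sup>2 *\<^sub>R root_comp \<rho> x"
  by (simp add: root_comp_def linear_sum[OF linear_br_right] br_simps Z_eigen root_indices_def
      scaleR_sum_right mult.commute)

lemma D_root_comp: "\<rho> \<in> P \<Longrightarrow> D (root_comp \<rho> x) = (\<rho> w0)\<^sup>2 *\<^sub>R root_comp \<rho> x"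
  unfolding D_def by (rule root_comp_eigen[OF _ w0])

lemma D_m: "x \<in> mm \<Longrightarrow> D x = 0"
  using m_comm w0 by (simp add: D_eq_0)

lemma k_decomp:
  assumes "x \<in> kk"
  shows "x = m_comp x + (\<Sum>\<rho>\<in>P. root_comp \<rho> x)"
proof -
  have "iprod y (x - m_comp x) = 0" if "y \<in> mm" for y
  proof -
    have "iprod (Y \<alpha>) x = iprod (Y \<alpha>) (m_comp x)" if \<alpha>: "\<alpha> \<in> {1..dim mm}" for \<alpha>
    proof -
      have "iprod (Y \<alpha>) (m_comp x) = (\<Sum>\<beta>\<in>{1..dim mm}. if \<alpha> = \<beta> then iprod (Y \<beta>) x else 0)"
        unfolding m_comp_def linear_sum[OF linear_iprod_right] using basis_Y \<alpha>
        by (intro sum.cong) (auto simp: iprod_simps orthonormal_basis_def)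
      then show ?thesis using \<alpha> by simp
    qed
    then have "iprod (Y \<alpha>) (x - m_comp x) = 0" if "\<alpha> \<in> {1..dim mm}" for \<alpha>
      using that by (simp add: iprod_simps)
    moreover have "iprod y (x - m_comp x) =
        iprod (\<Sum>\<alpha>\<in>{1..dim mm}. iprod (Y \<alpha>) y *\<^sub>R Y \<alpha>) (x - m_comp x)"
      using orthonormal_basis_expansion[OF basis_Y _ that] by (intro arg_cong2[of _ _ _ _ iprod]) simp_all
    ultimately show ?thesis
      by (simp add: iprod_sum_left)
  qed
  then have perp: "x - m_comp x \<in> ortho iprod mm \<inter> kk"
    using assms m_comp_m[of x] m_k subspace_k by (auto simp: ortho_def subspace_diff)
  have "x - m_comp x = (\<Sum>i\<in>root_indices br \<aa> P. iprod (Z i) (x - m_comp x) *\<^sub>R Z i)"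
    by (rule orthonormal_basis_expansion[OF basis_Z finite_root_indices perp])
  \<comment> \<open>Subtracting \<open>m_comp x\<close> leaves the coefficients unchanged, since
    \<open>Z i\<close> is orthogonal to \<open>mm\<close>.\<close>
  also have "\<dots> = (\<Sum>i\<in>root_indices br \<aa> P. iprod (Z i) x *\<^sub>R Z i)"
  proof (intro sum.cong refl)
    fix i assume "i \<in> root_indices br \<aa> P"
    then have "iprod (Z i) (m_comp x) = 0"
      using Z_mem m_comp_m[of x] iprod_commute[of "Z i"] by (auto simp: ortho_def)
    then show "iprod (Z i) (x - m_comp x) *\<^sub>R Z i = iprod (Z i) x *\<^sub>R Z i" by (simp add: iprod_simps)
  qed
  also have "\<dots> = (\<Sum>\<rho>\<in>P. root_comp \<rho> x)"
    unfolding root_comp_def root_indices_def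
    by (subst sum.Sigma) (use finite_P in auto)
  finally show ?thesis by (simp add: algebra_simps)
qed

lemma h_comp_plus_perp_comp: "x \<in> kk \<Longrightarrow> h_comp x + perp_comp x = x"
  using k_decomp[of x] sum.subset_diff[of \<Phi> P "\<lambda>\<rho>. root_comp \<rho> x"] finite_P
  by (simp add: h_comp_def perp_comp_def add.assoc)

lemma h_comp_k: "h_comp x \<in> kk" and perp_comp_k: "perp_comp x \<in> kk"
  unfolding h_comp_def perp_comp_def using m_comp_m m_k root_comp_k
  by (auto intro!: subspace_add[OF subspace_k] subspace_sum[OF subspace_k])

lemma D_h_comp: "D (h_comp x) = 0"
  unfolding h_comp_def by (simp add: D_simps D_m m_comp_m D_root_comp)

lemma w0_h_comp: "br w0 (h_comp x) = 0"
  using D_h_comp D_eq_0 by simp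

lemma D_perp_comp: "x \<in> kk \<Longrightarrow> D (perp_comp x) = D x"
  using h_comp_plus_perp_comp[of x] D_h_comp[of x] by (metis D_simps(1) add_0)

lemma D_expansion: "x \<in> kk \<Longrightarrow> D x = (\<Sum>\<rho>\<in>P. (\<rho> w0)\<^sup>2 *\<^sub>R root_comp \<rho> x)"
  using k_decomp[of x] D_m[OF m_comp_m[of x]] by (metis (no_types, lifting) D_root_comp D_simps(1,6) add_0 sum.cong)

lemma D_expansion': "x \<in> kk \<Longrightarrow> D x = (\<Sum>\<rho>\<in>\<Phi>. (\<rho> w0)\<^sup>2 *\<^sub>R root_comp \<rho> x)"
  using D_perp_comp[of x] by (simp add: perp_comp_def D_simps D_root_comp)

text \<open>Eigenvectors of the self-adjoint \<open>D\<close> for nonzero eigenvalues are orthogonal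
  to its kernel.\<close>

lemma perp_comp_orthogonal:
  assumes "br w0 c = 0"
  shows "iprod c (perp_comp x) = 0"
proof -
  have "iprod c (root_comp \<rho> x) = 0" if "\<rho> \<in> \<Phi>" for \<rho>
  proof -
    have "(\<rho> w0)\<^sup>2 * iprod c (root_comp \<rho> x) = iprod c (D (root_comp \<rho> x))"
      using that by (simp add: D_root_comp iprod_simps)
    also have "\<dots> = 0" using assms D_eq_0[of c] iprod_D[of c "root_comp \<rho> x"] by (simp add: iprod_simps)
    finally show ?thesis using that by simp
  qed
  then show ?thesis by (simp add: perp_comp_def linear_sum[OF linear_iprod_right])
qed

text \<open>The discrepancy lies in the kernel of ad(w0) and is orthogonal to that kernel.
  Automorphisms can be applied to this description, but not to the one by bases.\<close>

lemma h_comp_unique: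
  assumes "a \<in> kk" "b \<in> kk" "br w0 a = 0" "\<And>c. c \<in> kk \<Longrightarrow> br w0 c = 0 \<Longrightarrow> iprod c b = 0"
  shows "h_comp (a + b) = a" "perp_comp (a + b) = b"
proof -
  let ?c = "h_comp (a + b) - a"
  have c: "?c \<in> kk" "br w0 ?c = 0"
    using h_comp_k assms w0_h_comp subspace_k by (auto simp: subspace_diff br_simps)
  have s: "h_comp (a + b) + perp_comp (a + b) = a + b"
    using h_comp_plus_perp_comp assms subspace_k by (simp add: subspace_add)
  then have "?c = b - perp_comp (a + b)" by (simp add: algebra_simps)
  then have "iprod ?c ?c = iprod ?c b - iprod ?c (perp_comp (a + b))" by (metis iprod_simps(2))
  also have "\<dots> = 0" using assms(4) c perp_comp_orthogonal by simp
  finally have "?c = 0" using iprod_pos[of ?c] by force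
  then show "h_comp (a + b) = a" by simp
  with s show "perp_comp (a + b) = b" by simp
qed

text \<open>Equal squares give equal values at a point \<open>v\<close> where both roots are
  positive; comparing squares at \<open>w + v\<close> then yields
  \<open>\<rho> w * \<rho> v = \<sigma> w * \<rho> v\<close>. Positivity is what excludes opposite
  roots.\<close>

lemma positive_roots_sq_separated:
  assumes "\<rho> \<in> P" "\<sigma> \<in> P" "\<rho> \<noteq> \<sigma>"
  shows "\<exists>w\<in>\<aa>. (\<rho> w)\<^sup>2 \<noteq> (\<sigma> w)\<^sup>2"
proof (rule ccontr)
  assume "\<not> ?thesis"
  then have eq: "(\<rho> w)\<^sup>2 = (\<sigma> w)\<^sup>2" if "w \<in> \<aa>" for w using that by blast
  obtain v where v: "v \<in> \<aa>" "\<rho> v > 0" "\<sigma> v > 0"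
    using positive assms by (auto simp: positive_roots_def)
  then have \<rho>\<sigma>v: "\<rho> v = \<sigma> v" using eq[of v] by (simp add: power2_eq_iff)
  have "\<rho> w = \<sigma> w" if w: "w \<in> \<aa>" for w
  proof -
    have "\<rho> (w + v) = \<rho> w + \<rho> v" "\<sigma> (w + v) = \<sigma> w + \<sigma> v"
      using positive assms v w by (auto simp: positive_roots_def restricted_roots_def)
    then have "(\<rho> w + \<rho> v)\<^sup>2 = (\<sigma> w + \<sigma> v)\<^sup>2"
      using eq[of "w + v"] subspace_add[OF subspace_a w v(1)] by simp
    then have "\<rho> w * \<rho> v = \<sigma> w * \<rho> v"
      using eq[OF w] \<rho>\<sigma>v by (simp add: power2_eq_square algebra_simps)
    with v show ?thesis by simp
  qed
  moreover have "\<rho> \<in> extensional \<aa>" "\<sigma> \<in> extensional \<aa>"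
    using positive assms by (auto simp: positive_roots_def restricted_roots_def)
  ultimately show False using assms(3) extensionalityI by blast
qed

text \<open>The right side expands over all pairs of roots, while the first sum of
  \<open>Lambda\<close> pairs each root with itself only. The off-diagonal pairs vanish.\<close>

lemma Lambda_m_term:
  assumes "u \<in> mm" "x \<in> kk" "y \<in> kk"
  shows "(\<Sum>\<rho>\<in>P. (\<rho> w0)\<^sup>2 * iprod u (br (root_comp \<rho> x) (root_comp \<rho> y))) = iprod u (br (D x) y)"
proof -
  have uk: "u \<in> kk" and uw: "br w u = 0" if "w \<in> \<aa>" for w
    using assms(1) m_k m_comm that by auto
  have cross: "iprod u (br (root_comp \<rho> x) (root_comp \<sigma> y)) = 0" if *: "\<rho> \<in> P" "\<sigma> \<in> P" "\<rho> \<noteq> \<sigma>" for \<rho> \<sigma>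
  proof -
    obtain w where w: "w \<in> \<aa>" "(\<rho> w)\<^sup>2 \<noteq> (\<sigma> w)\<^sup>2"
      using positive_roots_sq_separated[OF *] by blast
    \<comment> \<open>Both sides are multiples of the same number, with factors that differ by the
      choice of \<open>w\<close>.\<close>
    have "iprod u (br (br w (br w (root_comp \<rho> x))) (root_comp \<sigma> y)) =
        iprod u (br (root_comp \<rho> x) (br w (br w (root_comp \<sigma> y))))"
      using w a_subset uk uw root_comp_k that by (intro iprod_br_h) auto
    then have "(\<rho> w)\<^sup>2 * iprod u (br (root_comp \<rho> x) (root_comp \<sigma> y)) =
        (\<sigma> w)\<^sup>2 * iprod u (br (root_comp \<rho> x) (root_comp \<sigma> y))"
      using w that by (simp add: root_comp_eigen br_simps iprod_simps)
    with w show ?thesis by simp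
  qed
  \<comment> \<open>Once moved over, \<open>D\<close> kills the \<open>mm\<close> component of
    \<open>y\<close>, and only root components remain.\<close>
  have "iprod u (br (D x) (m_comp y)) = iprod u (br x (D (m_comp y)))"
    unfolding D_def using assms uk uw[OF w0] m_comp_m m_k by (intro iprod_br_h w0_p) auto
  then have "iprod u (br (D x) y) = iprod u (br (D x) (\<Sum>\<sigma>\<in>P. root_comp \<sigma> y))"
    using k_decomp[OF assms(3)] D_m[OF m_comp_m[of y]]
    by (metis (no_types, lifting) add_0 br_simps(1,5) iprod_simps(1,5))
  also have "\<dots> = (\<Sum>\<rho>\<in>P. (\<rho> w0)\<^sup>2 * iprod u (br (root_comp \<rho> x) (\<Sum>\<sigma>\<in>P. root_comp \<sigma> y)))"
    unfolding D_expansion[OF assms(2)] by (rule iprod_br_sum_left)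
  also have "\<dots> = (\<Sum>\<rho>\<in>P. (\<rho> w0)\<^sup>2 * iprod u (br (root_comp \<rho> x) (root_comp \<rho> y)))"
  proof (intro sum.cong refl arg_cong2[of _ _ _ _ "(*)"])
    fix \<rho> assume \<rho>: "\<rho> \<in> P"
    have "iprod u (br (root_comp \<rho> x) (\<Sum>\<sigma>\<in>P. root_comp \<sigma> y)) =
        (\<Sum>\<sigma>\<in>P. iprod u (br (root_comp \<rho> x) (root_comp \<sigma> y)))"
      using iprod_br_sum_right[of u "root_comp \<rho> x" "\<lambda>_. 1"] by simp
    also have "\<dots> = (\<Sum>\<sigma>\<in>P. if \<sigma> = \<rho> then iprod u (br (root_comp \<rho> x) (root_comp \<rho> y)) else 0)"
      using cross \<rho> by (intro sum.cong) auto
    finally show "iprod u (br (root_comp \<rho> x) (\<Sum>\<sigma>\<in>P. root_comp \<sigma> y)) =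
        iprod u (br (root_comp \<rho> x) (root_comp \<rho> y))"
      using \<rho> finite_P by simp
  qed
  finally show ?thesis ..
qed

section \<open>The closed expression for \<Lambda> and its properties\<close>

definition Lambda_alg :: "'g \<Rightarrow> 'g \<Rightarrow> 'g \<Rightarrow> real" where
  "Lambda_alg u x y = iprod (D u) (br (perp_comp x) (perp_comp y)) - iprod (h_comp u) (br (D x) y)"

text \<open>The left side has the shape of \<open>Lambda\<close> after unfolding. The sums over
  \<open>mm\<close> and over the roots vanishing at \<open>w0\<close> yield the two parts of
  \<open>h_comp u\<close>. Each difference coming from a wedge is twice its first half, which
  cancels the factors 1/2.\<close>

lemma Lambda_expansion:
  assumes "u \<in> kk" "x \<in> kk" "y \<in> kk"
  shows "- 1/2 * (\<Sum>\<rho>\<in>P. \<Sum>a\<in>N \<rho>. \<Sum>b\<in>N \<rho>. \<Sum>\<alpha>\<in>{1..dim mm}.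
             (\<rho> w0)\<^sup>2 * iprod (Y \<alpha>) (br (Z (\<rho>, a)) (Z (\<rho>, b))) * iprod (Y \<alpha>) u *
             (iprod (Z (\<rho>, a)) x * iprod (Z (\<rho>, b)) y - iprod (Z (\<rho>, a)) y * iprod (Z (\<rho>, b)) x))
         - 1/2 * (\<Sum>\<rho>\<in>P - \<Phi>. \<Sum>\<mu>\<in>\<Phi>. \<Sum>\<nu>\<in>\<Phi>. \<Sum>a\<in>N \<rho>. \<Sum>b\<in>N \<mu>. \<Sum>d\<in>N \<nu>.
             (\<mu> w0)\<^sup>2 * iprod (Z (\<rho>, a)) (br (Z (\<mu>, b)) (Z (\<nu>, d))) * iprod (Z (\<rho>, a)) u *
             (iprod (Z (\<mu>, b)) x * iprod (Z (\<nu>, d)) y - iprod (Z (\<mu>, b)) y * iprod (Z (\<nu>, d)) x))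
         + 1/2 * (\<Sum>\<rho>\<in>P. \<Sum>\<mu>\<in>\<Phi>. \<Sum>\<nu>\<in>\<Phi>. \<Sum>a\<in>N \<rho>. \<Sum>b\<in>N \<mu>. \<Sum>d\<in>N \<nu>.
             (\<rho> w0)\<^sup>2 * iprod (Z (\<rho>, a)) (br (Z (\<mu>, b)) (Z (\<nu>, d))) * iprod (Z (\<rho>, a)) u *
             (iprod (Z (\<mu>, b)) x * iprod (Z (\<nu>, d)) y - iprod (Z (\<mu>, b)) y * iprod (Z (\<nu>, d)) x))
       = Lambda_alg u x y"
    (is "- 1/2 * ?S1 - 1/2 * ?S2 + 1/2 * ?S3 = _")
proof -
  define h0 where "h0 = (\<Sum>\<rho>\<in>P - \<Phi>. root_comp \<rho> u)"
  have h: "h_comp u = m_comp u + h0" by (simp add: h_comp_def h0_def)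
  \<comment> \<open>Moving the sum over \<alpha> outside those over \<open>a\<close> and
    \<open>b\<close> produces the pattern of \<open>iprod_br_wedge_sums\<close>.\<close>
  have "?S1 = (\<Sum>\<rho>\<in>P. \<Sum>\<alpha>\<in>{1..dim mm}. \<Sum>a\<in>N \<rho>. \<Sum>b\<in>N \<rho>.
             (\<rho> w0)\<^sup>2 * iprod (Y \<alpha>) (br (Z (\<rho>, a)) (Z (\<rho>, b))) * iprod (Y \<alpha>) u *
             (iprod (Z (\<rho>, a)) x * iprod (Z (\<rho>, b)) y - iprod (Z (\<rho>, a)) y * iprod (Z (\<rho>, b)) x))"
    by (rule sum.cong[OF refl], rule trans[OF sum.cong[OF refl sum.swap] sum.swap])
  also have "\<dots> = (\<Sum>\<rho>\<in>P. (\<rho> w0)\<^sup>2 * iprod (m_comp u) (br (root_comp \<rho> x) (root_comp \<rho> y)))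
      - (\<Sum>\<rho>\<in>P. (\<rho> w0)\<^sup>2 * iprod (m_comp u) (br (root_comp \<rho> y) (root_comp \<rho> x)))"
    unfolding iprod_br_wedge_sums m_comp_def root_comp_def
    unfolding right_diff_distrib sum_subtractf ..
  also have "\<dots> = iprod (m_comp u) (br (D x) y) - iprod (m_comp u) (br (D y) x)"
    using assms by (simp add: Lambda_m_term m_comp_m)
  also have "iprod (m_comp u) (br (D y) x) = iprod (m_comp u) (br y (D x))"
    unfolding D_def using assms m_comp_m[of u] m_k m_comm w0 by (intro iprod_br_h w0_p) auto
  finally have S1: "?S1 = 2 * iprod (m_comp u) (br (D x) y)"
    using br_commute[of y "D x"] by (simp add: iprod_simps)
  have h0: "h0 \<in> kk" "br w0 h0 = 0"
    unfolding h0_def using root_comp_k D_root_comp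
    by (auto intro!: subspace_sum[OF subspace_k] simp: D_simps simp flip: D_eq_0)
  \<comment> \<open>The sum over \<nu> is restricted to \<open>\<Phi>\<close> and so gives only
    \<open>perp_comp b\<close>; moving \<open>D\<close> onto it removes the projection.\<close>
  have D_br: "iprod h0 (br (D a) (perp_comp b)) = iprod h0 (br a (D b))" if "a \<in> kk" "b \<in> kk" for a b
    using that h0 iprod_br_h[OF w0_p h0 that(1) perp_comp_k[of b]] D_perp_comp[OF that(2)]
    by (simp add: D_def)
  have "?S2 = (\<Sum>\<rho>\<in>P - \<Phi>. \<Sum>\<mu>\<in>\<Phi>. \<Sum>\<nu>\<in>\<Phi>.
        (\<mu> w0)\<^sup>2 * iprod (root_comp \<rho> u) (br (root_comp \<mu> x) (root_comp \<nu> y)))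
      - (\<Sum>\<rho>\<in>P - \<Phi>. \<Sum>\<mu>\<in>\<Phi>. \<Sum>\<nu>\<in>\<Phi>.
        (\<mu> w0)\<^sup>2 * iprod (root_comp \<rho> u) (br (root_comp \<mu> y) (root_comp \<nu> x)))"
    unfolding iprod_br_wedge_sums root_comp_def
    unfolding right_diff_distrib sum_subtractf ..
  also have "\<dots> = iprod h0 (br (D x) (perp_comp y)) - iprod h0 (br (D y) (perp_comp x))"
    unfolding iprod_br_sums_scaled D_expansion'[OF assms(2)] D_expansion'[OF assms(3)] perp_comp_def h0_def ..
  also have "\<dots> = iprod h0 (br x (D y)) - iprod h0 (br y (D x))" using assms by (simp add: D_br)
  also have "iprod h0 (br x (D y)) = iprod h0 (br (D x) y)"
    using iprod_br_h[OF w0_p h0 assms(2,3)] by (simp add: D_def)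
  finally have S2: "?S2 = 2 * iprod h0 (br (D x) y)"
    using br_commute[of y "D x"] by (simp add: iprod_simps)
  have D3: "(\<Sum>\<rho>\<in>P. \<Sum>\<mu>\<in>\<Phi>. \<Sum>\<nu>\<in>\<Phi>.
        (\<rho> w0)\<^sup>2 * iprod (root_comp \<rho> u) (br (root_comp \<mu> a) (root_comp \<nu> b))) =
      iprod (D u) (br (perp_comp a) (perp_comp b))" for a b
    unfolding D_expansion[OF assms(1)] perp_comp_def
    using iprod_br_sums[of "\<lambda>\<rho>. (\<rho> w0)\<^sup>2" "\<lambda>\<rho>. root_comp \<rho> u" P "\<lambda>_. 1" "\<lambda>\<mu>. root_comp \<mu> a" \<Phi>
        "\<lambda>_. 1" "\<lambda>\<nu>. root_comp \<nu> b" \<Phi>] by simp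
  have "?S3 = (\<Sum>\<rho>\<in>P. \<Sum>\<mu>\<in>\<Phi>. \<Sum>\<nu>\<in>\<Phi>.
        (\<rho> w0)\<^sup>2 * iprod (root_comp \<rho> u) (br (root_comp \<mu> x) (root_comp \<nu> y)))
      - (\<Sum>\<rho>\<in>P. \<Sum>\<mu>\<in>\<Phi>. \<Sum>\<nu>\<in>\<Phi>.
        (\<rho> w0)\<^sup>2 * iprod (root_comp \<rho> u) (br (root_comp \<mu> y) (root_comp \<nu> x)))"
    unfolding iprod_br_wedge_sums root_comp_def
    unfolding right_diff_distrib sum_subtractf ..
  then have S3: "?S3 = 2 * iprod (D u) (br (perp_comp x) (perp_comp y))"
    unfolding D3 using br_commute[of "perp_comp y" "perp_comp x"] by (simp add: iprod_simps)
  show ?thesis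
    unfolding S1 S2 S3 Lambda_alg_def h by (simp add: iprod_simps)
qed

text \<open>Split \<open>u\<close> and \<open>y\<close> into components in [u, y]. The brackets of
  \<open>h_comp u\<close> with \<open>y\<close> and of the two complements give the two terms of
  \<open>Lambda_alg\<close>. The bracket of \<open>perp_comp u\<close> with
  \<open>c = h_comp y\<close> contributes nothing, because ad(c) is skew and commutes with the
  self-adjoint \<open>D\<close>.\<close>

lemma Lambda_alg_diagonal:
  assumes "u \<in> kk" "y \<in> kk"
  shows "Lambda_alg u u y = iprod (D u) (br u y)"
proof -
  let ?h = "h_comp u" and ?c = "h_comp y"
  have c: "?c \<in> kk" "br w0 ?c = 0" by (rule h_comp_k w0_h_comp)+
  \<comment> \<open>The number equals its own negative.\<close>
  have cu: "iprod (D u) (br ?c u) = 0"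
  proof -
    have "iprod (D u) (br ?c u) = iprod (br (D u) ?c) u" using c by (simp add: iprod_br_k)
    also have "\<dots> = - iprod (br ?c (D u)) u" using br_commute[of "D u" ?c] by (simp add: iprod_simps)
    also have "\<dots> = - iprod (D (br ?c u)) u" using c D_br_h by simp
    also have "\<dots> = - iprod (D u) (br ?c u)" using iprod_D[of "br ?c u" u] iprod_commute[of "br ?c u"] by simp
    finally show ?thesis by simp
  qed
  have ch: "iprod (D u) (br ?c ?h) = 0"
    using iprod_D[of u "br ?c ?h"] D_br_h[OF c(2)] D_h_comp by (simp add: br_simps iprod_simps)
  have "br ?c u = br ?c ?h + br ?c (perp_comp u)"
    using h_comp_plus_perp_comp[OF assms(1)] by (metis br_simps(1))
  with cu ch have "iprod (D u) (br ?c (perp_comp u)) = 0" by (simp add: iprod_simps)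
  then have bc: "iprod (D u) (br (perp_comp u) ?c) = 0"
    using br_commute[of "perp_comp u" ?c] by (simp add: iprod_simps)
  have hy: "iprod (D u) (br ?h y) = - iprod ?h (br (D u) y)"
    using br_commute[of "D u" ?h] iprod_br_k[OF h_comp_k, of "D u" u y] iprod_br_k[OF D_k[OF assms(1)], of ?h y]
    by (simp add: iprod_simps)
  have "br u y = br ?h y + br (perp_comp u) y"
    using h_comp_plus_perp_comp[OF assms(1)] by (metis br_simps(6))
  moreover have "br (perp_comp u) y = br (perp_comp u) ?c + br (perp_comp u) (perp_comp y)"
    using h_comp_plus_perp_comp[OF assms(2)] by (metis br_simps(1))
  ultimately show ?thesis
    using bc hy by (simp add: Lambda_alg_def iprod_simps)
qed

lemma Lambda_alg_horizontal:
  assumes "x \<in> kk" "br w0 x = 0"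
  shows "Lambda_alg u x y = 0"
proof -
  \<comment> \<open>Adding 0 exhibits \<open>x\<close> as a decomposition to which
    \<open>h_comp_unique\<close> applies.\<close>
  have "perp_comp (x + 0) = 0"
    using assms subspace_0[OF subspace_k] by (intro h_comp_unique) (auto simp: iprod_simps)
  then show ?thesis using assms D_eq_0[of x] by (simp add: Lambda_alg_def br_simps iprod_simps)
qed

text \<open>\<phi> and \<psi> stand for Ad(h) and its inverse. Ad(h) need not preserve \<aa> or the
  chosen bases, but it commutes with \<open>D\<close> and is orthogonal on \<kk>, so it respects the
  kernel and its complement.\<close>

lemma Lambda_alg_invariant:
  assumes lin: "linear \<phi>" and inv: "\<And>x. \<phi> (\<psi> x) = x" "\<And>x. \<psi> (\<phi> x) = x"
    and k: "\<And>x. x \<in> kk \<Longrightarrow> \<phi> x \<in> kk" "\<And>x. x \<in> kk \<Longrightarrow> \<psi> x \<in> kk"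
    and hom: "\<And>x y. \<phi> (br x y) = br (\<phi> x) (\<phi> y)" and w: "\<phi> w0 = w0"
    and orth: "\<And>x y. x \<in> kk \<Longrightarrow> y \<in> kk \<Longrightarrow> iprod (\<phi> x) (\<phi> y) = iprod x y"
    and "u \<in> kk" "x \<in> kk" "y \<in> kk"
  shows "Lambda_alg (\<phi> u) (\<phi> x) (\<phi> y) = Lambda_alg u x y"
proof -
  have D\<phi>: "D (\<phi> x) = \<phi> (D x)" for x by (simp add: D_def hom w)
  have *: "h_comp (\<phi> x) = \<phi> (h_comp x)" "perp_comp (\<phi> x) = \<phi> (perp_comp x)" if "x \<in> kk" for x
  proof -
    have "iprod c (\<phi> (perp_comp x)) = 0" if c: "c \<in> kk" "br w0 c = 0" for c
    proof -
      have "\<phi> (br w0 (\<psi> c)) = 0" using c by (simp add: hom w inv)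
      then have "br w0 (\<psi> c) = 0" by (metis inv(2) lin linear_0)
      then show ?thesis
        using perp_comp_orthogonal[of "\<psi> c" x] orth[of "\<psi> c" "perp_comp x"] k(2)[OF c(1)] perp_comp_k
        by (simp add: inv)
    qed
    moreover have "br w0 (\<phi> (h_comp x)) = 0"
      using w0_h_comp[of x] by (metis hom w lin linear_0)
    moreover have "\<phi> x = \<phi> (h_comp x) + \<phi> (perp_comp x)"
      using h_comp_plus_perp_comp[OF that] by (metis lin linear_add)
    ultimately show "h_comp (\<phi> x) = \<phi> (h_comp x)" "perp_comp (\<phi> x) = \<phi> (perp_comp x)"
      using h_comp_unique[of "\<phi> (h_comp x)" "\<phi> (perp_comp x)"] k(1) h_comp_k perp_comp_k by auto
  qed
  show ?thesis
    using assms(9-) unfolding Lambda_alg_def *(1)[OF assms(9)] *(2)[OF assms(10)] *(2)[OF assms(11)] D\<phi>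
    by (simp add: orth D_k h_comp_k perp_comp_k br_k_k flip: hom)
qed

end

text \<open>\<open>S\<close> and \<open>R\<close> stand for \<open>Ad(s)\<close> and \<open>Ad(s\<inverse>)\<close> at a point \<open>s \<in> K\<close>.\<close>

locale inertia_frame = root_basis br \<theta> \<aa> P Y Z w0
  for br :: "'g::euclidean_space \<Rightarrow> 'g \<Rightarrow> 'g" and \<theta> \<aa> P Y Z w0 +
  fixes \<I> S R :: "'g \<Rightarrow> 'g"
  assumes inertia: "inertia_tensor iprod (k_part \<theta>) \<I>"
    and linear_S: "linear S" and linear_R: "linear R"
    and S_R [simp]: "S (R x) = x" and R_S [simp]: "R (S x) = x"
    and S_k: "x \<in> k_part \<theta> \<Longrightarrow> S x \<in> k_part \<theta>" and R_k: "x \<in> k_part \<theta> \<Longrightarrow> R x \<in> k_part \<theta>"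
    and S_br: "S (br x y) = br (S x) (S y)"
    and iprod_S_S: "x \<in> k_part \<theta> \<Longrightarrow> y \<in> k_part \<theta> \<Longrightarrow> iprod (S x) (S y) = iprod x y"
begin

section \<open>The symplectic form and the energy at a fixed base point\<close>

lemmas S_simps =
  linear_add[OF linear_S] linear_diff[OF linear_S] linear_neg[OF linear_S]
  linear_scale[OF linear_S] linear_0[OF linear_S]

lemmas R_simps =
  linear_add[OF linear_R] linear_diff[OF linear_R] linear_neg[OF linear_R]
  linear_scale[OF linear_R] linear_0[OF linear_R]

lemma I_k: "x \<in> kk \<Longrightarrow> \<I> x \<in> kk"
  and I_add: "x \<in> kk \<Longrightarrow> y \<in> kk \<Longrightarrow> \<I> (x + y) = \<I> x + \<I> y"
  and I_scale: "x \<in> kk \<Longrightarrow> \<I> (c *\<^sub>R x) = c *\<^sub>R \<I> x"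
  and iprod_I: "x \<in> kk \<Longrightarrow> y \<in> kk \<Longrightarrow> iprod (\<I> x) y = iprod x (\<I> y)"
  and iprod_I_pos: "x \<in> kk \<Longrightarrow> x \<noteq> 0 \<Longrightarrow> iprod (\<I> x) x > 0"
  using inertia by (auto simp: inertia_tensor_def)

lemma iprod_R: "x \<in> kk \<Longrightarrow> y \<in> kk \<Longrightarrow> iprod (R x) y = iprod x (S y)"
  using iprod_S_S[of "R x" y] R_k by simp

text \<open>The metric tensor at \<open>s\<close>. On \<kk> the map \<open>R\<close> is adjoint to
  \<open>S\<close>, so the second summand is positive semidefinite.\<close>

definition mu :: "'g \<Rightarrow> 'g" where "mu y = \<I> y + R (D (S y))"

lemma mu_k: "y \<in> kk \<Longrightarrow> mu y \<in> kk"
  unfolding mu_def using subspace_k by (intro subspace_add) (auto simp: I_k R_k D_k S_k)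

lemma mu_add: "x \<in> kk \<Longrightarrow> y \<in> kk \<Longrightarrow> mu (x + y) = mu x + mu y"
  and mu_scale: "x \<in> kk \<Longrightarrow> mu (c *\<^sub>R x) = c *\<^sub>R mu x"
  by (simp_all add: mu_def I_add I_scale S_simps R_simps D_simps algebra_simps)

lemma mu_0: "mu 0 = 0"
  using mu_scale[of 0 0] subspace_0[OF subspace_k] by simp

lemma iprod_mu: "x \<in> kk \<Longrightarrow> y \<in> kk \<Longrightarrow> iprod (mu x) y = iprod (\<I> x) y + iprod (D (S x)) (S y)"
  by (simp add: mu_def iprod_simps iprod_R D_k S_k)

lemma iprod_mu_commute: "x \<in> kk \<Longrightarrow> y \<in> kk \<Longrightarrow> iprod (mu x) y = iprod (mu y) x"
  using iprod_I[of x y] iprod_commute[of x "\<I> y"] iprod_D[of "S x" "S y"] iprod_commute[of "S x" "D (S y)"]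
  by (simp add: iprod_mu)

lemma iprod_mu_pos: "x \<in> kk \<Longrightarrow> x \<noteq> 0 \<Longrightarrow> iprod (mu x) x > 0"
  using iprod_I_pos[of x] iprod_pos[of "br w0 (S x)"] iprod_D_br[of "S x" "S x"]
  by (cases "br w0 (S x) = 0") (simp_all add: iprod_mu iprod_simps)

text \<open>The value of \<open>Omega_K\<close> at \<open>(s, u)\<close> on \<open>(x, y)\<close>
  and \<open>(x', y')\<close>. The last product arises once from each of the two derivatives of the
  canonical one-form and once, with opposite sign, from the bracket term, so that one copy
  remains.\<close>

definition Omega_alg :: "'g \<Rightarrow> 'g \<Rightarrow> 'g \<Rightarrow> 'g \<Rightarrow> 'g \<Rightarrow> real" where
  "Omega_alg u x y x' y' = iprod (mu y') x - iprod (mu y) x' + iprod (\<I> u) (br x x')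
     - iprod (D (br (S x) (S u))) (S x') + iprod (D (br (S x') (S u))) (S x)
     - iprod (D (S u)) (br (S x) (S x'))"

text \<open>The differential of \<open>H_c\<close> at \<open>(s, u)\<close> on
  \<open>(x', y')\<close>; the factor 1/2 is gone because \<open>mu\<close> and \<open>D\<close> are
  self-adjoint.\<close>

definition energy_diff :: "'g \<Rightarrow> 'g \<Rightarrow> 'g \<Rightarrow> real" where
  "energy_diff u x' y' = iprod (mu u) y' + iprod (D (S u)) (br (S x') (S u))"

text \<open>Test with \<open>(0, x)\<close> and then with \<open>(y, 0)\<close>: only the pairing of
  fibre and base by \<open>mu\<close> remains, since \<beta> sees base components alone.\<close>

lemma Omega_alg_plus_nondegenerate:
  assumes "x \<in> kk" "y \<in> kk" "u \<in> kk"
    and \<beta>: "\<And>x'. \<beta> 0 x' = 0" "\<And>x. \<beta> x 0 = 0"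
    and 0: "\<And>x' y'. x' \<in> kk \<Longrightarrow> y' \<in> kk \<Longrightarrow> Omega_alg u x y x' y' + \<beta> (S x) (S x') = 0"
  shows "x = 0" "y = 0"
proof -
  note z = subspace_0[OF subspace_k]
  have "iprod (mu x) x = 0"
    using 0[OF z assms(1)] \<beta> by (simp add: Omega_alg_def S_simps br_simps D_simps iprod_simps)
  then show "x = 0" using iprod_mu_pos[OF assms(1)] by force
  then have "iprod (mu y) y = 0"
    using 0[OF assms(2) z] \<beta> by (simp add: Omega_alg_def S_simps br_simps D_simps iprod_simps mu_0)
  then show "y = 0" using iprod_mu_pos[OF assms(2)] by force
qed

text \<open>For base component \<open>u\<close> all terms with \<open>D\<close> cancel against the
  added form and the energy. What remains is the Euler equation \<open>mu y = br (\<I> u) u\<close>,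
  tested with \<open>x'\<close>.\<close>

lemma Omega_alg_diagonal:
  assumes "x' \<in> kk" "y \<in> kk" "y' \<in> kk" "u \<in> kk"
  shows "Omega_alg u u y x' y' + iprod (D (S u)) (br (S u) (S x')) - energy_diff u x' y' =
    iprod (br (\<I> u) u) x' - iprod (mu y) x'"
proof -
  have "iprod (D (br (S x') (S u))) (S u) = iprod (D (S u)) (br (S x') (S u))"
    using iprod_D[of "br (S x') (S u)" "S u"] iprod_commute[of "br (S x') (S u)"] by simp
  then show ?thesis
    using assms iprod_mu_commute[of y' u] iprod_br_k[of u "\<I> u" x']
    by (simp add: Omega_alg_def energy_diff_def D_simps br_simps iprod_simps)
qed

text \<open>The equation forces \<open>x = u\<close>, and then \<open>\<mu> y = [\<I> u, u]\<close>.\<close>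

lemma nonholonomic_solution:
  assumes u: "u \<in> kk"
  obtains y where "y \<in> kk"
    "\<And>x y'. x \<in> kk \<and> y' \<in> kk \<and> (\<forall>x'\<in>kk. \<forall>y''\<in>kk. Omega_alg u x y' x' y'' +
       iprod (D (S u)) (br (S x) (S x')) = energy_diff u x' y'') \<longleftrightarrow> x = u \<and> y' = y"
proof -
  note z = subspace_0[OF subspace_k]
  have "\<exists>y\<in>kk. mu y = br (\<I> u) u"
    using iprod_mu_pos u
    by (intro k_endomorphism_surj mu_k mu_add mu_scale) (auto simp: br_k_k I_k iprod_simps, force simp: iprod_simps)
  then obtain y where y: "y \<in> kk" "mu y = br (\<I> u) u" by blast
  have "x = u \<and> y' = y"
    if xy: "x \<in> kk" "y' \<in> kk" and eq: "\<And>x' y''. x' \<in> kk \<Longrightarrow> y'' \<in> kk \<Longrightarrow> Omega_alg u x y' x' y'' +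
       iprod (D (S u)) (br (S x) (S x')) = energy_diff u x' y''" for x y'
  proof
    \<comment> \<open>A test vector without base component sees only the pairing by
      \<open>mu\<close>.\<close>
    have "iprod (mu v) x = iprod (mu v) u" if "v \<in> kk" for v
      using eq[OF z that] iprod_mu_commute[OF that u]
      by (simp add: Omega_alg_def energy_diff_def S_simps br_simps D_simps iprod_simps)
    moreover have xu: "x - u \<in> kk" using xy u subspace_k by (simp add: subspace_diff)
    ultimately have "iprod (mu (x - u)) (x - u) = 0" by (simp add: iprod_simps)
    then show x: "x = u" using iprod_mu_pos[OF xu] by force
    have "iprod (mu y') x' = iprod (br (\<I> u) u) x'" if "x' \<in> kk" for x'
      using eq[OF that z] Omega_alg_diagonal[OF that xy(2) z u] x by simp
    then have "mu y' = mu y"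
      using y mu_k[OF xy(2)] I_k[OF u] u by (intro iprod_eqI) (auto simp: br_k_k)
    moreover have "mu (y' + (-1) *\<^sub>R y) = mu y' + (-1) *\<^sub>R mu y"
      using xy y subspace_k mu_scale[OF y(1), of "-1"] by (subst mu_add) (auto simp: subspace_scale subspace_neg)
    moreover have "y' - y \<in> kk" using xy y subspace_k by (simp add: subspace_diff)
    ultimately show "y' = y" using iprod_mu_pos[of "y' - y"] by (force simp: iprod_simps)
  qed
  moreover have "Omega_alg u u y x' y'' + iprod (D (S u)) (br (S u) (S x')) = energy_diff u x' y''"
    if "x' \<in> kk" "y'' \<in> kk" for x' y''
    using Omega_alg_diagonal[OF that(1) y(1) that(2) u] y(2) by simp
  ultimately show thesis using that[OF y(1)] u y(1) by blast
qed

text \<open>As ad(T) is skew and commutes with \<open>D\<close>, the two products containing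
  [T, S x'] or [T, S u] with \<open>S x'\<close> cancel; products of \<open>T\<close> with values of
  \<open>D\<close> vanish. Only the inertia tensor survives.\<close>

lemma Omega_alg_generator:
  assumes "T \<in> kk" "br w0 T = 0" "u \<in> kk" "x' \<in> kk" "y' \<in> kk"
  shows "Omega_alg u (R T) 0 x' y' = iprod (\<I> y') (R T) - iprod (\<I> u) (br x' (R T))"
proof -
  have DT: "D T = 0" using assms(2) D_eq_0 by simp
  have "iprod (D (br T (S u))) (S x') = iprod (br T (D (S u))) (S x')"
    using D_br_h[OF assms(2)] by simp
  also have "\<dots> = - iprod (br (D (S u)) T) (S x')"
    using br_commute[of T "D (S u)"] by (simp add: iprod_simps)
  also have "\<dots> = - iprod (D (S u)) (br T (S x'))"
    using assms by (simp add: iprod_br_k)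
  finally have 1: "iprod (D (br T (S u))) (S x') = - iprod (D (S u)) (br T (S x'))" .
  have 2: "iprod (D a) T = 0" for a using iprod_D[of a T] DT by (simp add: iprod_simps)
  show ?thesis
    using assms 1 2 br_commute[of "R T" x']
    by (simp add: Omega_alg_def iprod_mu R_k mu_0 iprod_simps)
qed

end

section \<open>The adjoint representation\<close>

lemma prod_top_of_set:
  "prod_topology (top_of_set S) (top_of_set T) = top_of_set (S \<times> T)"
  by (simp add: prod_topology_subtopology subtopology_subtopology Times_Int_Times
      euclidean_product_topology)

lemma has_derivative_transform_nhds:
  assumes "(f has_derivative D) (at x)" "eventually (\<lambda>y. f y = g y) (nhds x)"
  shows "(g has_derivative D) (at x)"
  using has_derivative_transform_eventually[OF assms(1), of g] assms(2)
  by (simp add: eventually_nhds_conv_at)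

lemma smooth_on_differentiable:
  assumes "smooth_on f S" "x \<in> S"
  shows "f differentiable (at x)"
    and "(\<lambda>q. frechet_derivative f (at q) v) differentiable (at x)"
proof -
  \<comment> \<open>Two levels suffice: Ad uses a first derivative of the multiplication and the
    bracket a second one.\<close>
  have "k_smooth_on (Suc (Suc 0)) f S" using assms(1) unfolding smooth_on_def by blast
  then have *: "(\<forall>x\<in>S. f differentiable (at x)) \<and>
      (\<forall>v. k_smooth_on (Suc 0) (\<lambda>q. frechet_derivative f (at q) v) S)"
    by (subst (asm) k_smooth_on.simps(2))
  from conjunct1[OF this] assms(2) show "f differentiable (at x)" by blast
  from spec[OF conjunct2[OF *], of v] assms(2)
  show "(\<lambda>q. frechet_derivative f (at q) v) differentiable (at x)"
    by simp
qed

text \<open>The charts are independent of each other, because the factors and the product need not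
  lie in a common one.\<close>

definition mult_chart ::
  "('a, 'g::euclidean_space) lie_group_data \<Rightarrow> ('a, 'g) chart \<Rightarrow> ('a, 'g) chart \<Rightarrow> ('a, 'g) chart \<Rightarrow>
   'g \<times> 'g \<Rightarrow> 'g" where
  "mult_chart G c1 c2 c3 =
     (\<lambda>(a, b). snd c3 (inv_into (fst c1) (snd c1) a \<otimes>\<^bsub>G\<^esub> inv_into (fst c2) (snd c2) b))"

locale lie_grp =
  fixes G :: "('a, 'g::euclidean_space) lie_group_data" (structure)
  assumes lie_group: "lie_group G"
begin

sublocale group G using lie_group unfolding lie_group_def by (elim conjE)

section \<open>Charts of the group and multiplication in charts\<close>

lemma topspace_topo [simp]: "topspace (topo G) = carrier G"
  using lie_group unfolding lie_group_def by (elim conjE)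

lemma smooth_manifold: "smooth_manifold (topo G) (charts G)"
  using lie_group unfolding lie_group_def by (elim conjE)

lemma
  assumes "c \<in> charts G"
  shows chart_openin: "openin (topo G) (fst c)"
    and chart_open_image: "open (snd c ` fst c)"
    and chart_homeomorphic:
      "homeomorphic_map (subtopology (topo G) (fst c)) (top_of_set (snd c ` fst c)) (snd c)"
proof -
  have "\<forall>(U, \<phi>)\<in>charts G. openin (topo G) U \<and> open (\<phi> ` U) \<and>
      homeomorphic_map (subtopology (topo G) U) (top_of_set (\<phi> ` U)) \<phi>"
    using smooth_manifold unfolding smooth_manifold_def by meson
  from bspec[OF this assms] show "openin (topo G) (fst c)" "open (snd c ` fst c)"
    "homeomorphic_map (subtopology (topo G) (fst c)) (top_of_set (snd c ` fst c)) (snd c)"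
    by (simp_all add: case_prod_beta)
qed

lemma chart_carrier: "c \<in> charts G \<Longrightarrow> x \<in> fst c \<Longrightarrow> x \<in> carrier G"
  using openin_subset[OF chart_openin, of c] by auto

lemma chart_topspace: "c \<in> charts G \<Longrightarrow> topspace (subtopology (topo G) (fst c)) = fst c"
  using chart_carrier[of c] by auto

lemma chart_inj: "c \<in> charts G \<Longrightarrow> inj_on (snd c) (fst c)"
  using chart_homeomorphic[of c] chart_topspace[of c]
  by (metis homeomorphic_imp_injective_map)

lemma chart_inv_continuous:
  assumes "c \<in> charts G"
  shows "continuous_map (top_of_set (snd c ` fst c)) (topo G) (inv_into (fst c) (snd c))"
proof -
  obtain g where g: "homeomorphic_maps (subtopology (topo G) (fst c))
      (top_of_set (snd c ` fst c)) (snd c) g"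
    using chart_homeomorphic[OF assms] homeomorphic_map_maps by blast
  then have "continuous_map (top_of_set (snd c ` fst c)) (subtopology (topo G) (fst c)) g"
    by (simp add: homeomorphic_maps_def)
  then have "continuous_map (top_of_set (snd c ` fst c)) (topo G) g"
    using continuous_map_into_fulltopology by blast
  moreover have "g y = inv_into (fst c) (snd c) y" if "y \<in> topspace (top_of_set (snd c ` fst c))" for y
    using that g chart_inj[OF assms] chart_topspace[OF assms]
    by (auto simp: homeomorphic_maps_def)
  ultimately show ?thesis by (rule continuous_map_eq)
qed

lemma chart_at: "x \<in> carrier G \<Longrightarrow> \<exists>c\<in>charts G. x \<in> fst c"
proof -
  assume "x \<in> carrier G"
  moreover have "(\<Union>c\<in>charts G. fst c) = topspace (topo G)"
    using smooth_manifold unfolding smooth_manifold_def by meson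
  ultimately show ?thesis by auto
qed

lemma mult_smooth:
  "smooth_map (prod_topology (topo G) (topo G)) (prod_charts (charts G) (charts G))
       (topo G) (charts G) (\<lambda>(x, y). x \<otimes> y)"
  using lie_group unfolding lie_group_def by (elim conjE)

lemma mult_continuous:
  "continuous_map (prod_topology (topo G) (topo G)) (topo G) (\<lambda>(x, y). x \<otimes> y)"
  using mult_smooth by (simp add: smooth_map_def)

lemma inv_smooth: "smooth_map (topo G) (charts G) (topo G) (charts G) (\<lambda>x. inv x)"
  using lie_group unfolding lie_group_def by (elim conjE)

lemma inv_continuous: "continuous_map (topo G) (topo G) (\<lambda>x. inv x)"
  using inv_smooth by (simp add: smooth_map_def)

lemma conj_continuous:
  assumes "s \<in> carrier G"
  shows "continuous_map (topo G) (topo G) (\<lambda>x. s \<otimes> x \<otimes> inv s)"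
proof -
  have mult: "continuous_map (topo G) (topo G) (\<lambda>x. h x \<otimes> k x)"
    if "continuous_map (topo G) (topo G) h" "continuous_map (topo G) (topo G) k" for h k
    using continuous_map_compose[OF continuous_map_pairedI[OF that] mult_continuous]
    by (simp add: o_def)
  show ?thesis
    using assms by (intro mult) (auto simp: continuous_map_const continuous_map_id[unfolded id_def])
qed

definition mult_domain :: "('a, 'g) chart \<Rightarrow> ('a, 'g) chart \<Rightarrow> ('a, 'g) chart \<Rightarrow> ('g \<times> 'g) set" where
  "mult_domain c1 c2 c3 = {q \<in> snd c1 ` fst c1 \<times> snd c2 ` fst c2.
     inv_into (fst c1) (snd c1) (fst q) \<otimes> inv_into (fst c2) (snd c2) (snd q) \<in> fst c3}"

lemma open_mult_domain:
  assumes "c1 \<in> charts G" "c2 \<in> charts G" "c3 \<in> charts G"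
  shows "open (mult_domain c1 c2 c3)"
proof -
  let ?D = "snd c1 ` fst c1 \<times> snd c2 ` fst c2"
  have 1: "continuous_map (top_of_set ?D) (topo G) (\<lambda>q. inv_into (fst c1) (snd c1) (fst q))"
    using continuous_map_compose[OF continuous_map_fst chart_inv_continuous[OF assms(1)], of "top_of_set (snd c2 ` fst c2)"]
    by (simp add: prod_top_of_set o_def)
  have 2: "continuous_map (top_of_set ?D) (topo G) (\<lambda>q. inv_into (fst c2) (snd c2) (snd q))"
    using continuous_map_compose[OF continuous_map_snd chart_inv_continuous[OF assms(2)], of "top_of_set (snd c1 ` fst c1)"]
    by (simp add: prod_top_of_set o_def)
  have "continuous_map (top_of_set ?D) (topo G)
    (\<lambda>q. inv_into (fst c1) (snd c1) (fst q) \<otimes> inv_into (fst c2) (snd c2) (snd q))"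
    using continuous_map_compose[OF continuous_map_pairedI[OF 1 2] mult_continuous]
    by (simp add: o_def)
  from openin_continuous_map_preimage[OF this chart_openin[OF assms(3)]]
  have "openin (top_of_set ?D) (mult_domain c1 c2 c3)"
    by (simp add: mult_domain_def)
  moreover have "open ?D" using assms chart_open_image by (simp add: open_Times)
  ultimately show ?thesis using openin_open_eq by blast
qed

lemma
  assumes c: "c1 \<in> charts G" "c2 \<in> charts G" "c3 \<in> charts G" and p: "p \<in> mult_domain c1 c2 c3"
  shows mult_chart_differentiable: "mult_chart G c1 c2 c3 differentiable at p"
    and mult_chart_differentiable2:
      "(\<lambda>q. frechet_derivative (mult_chart G c1 c2 c3) (at q) v) differentiable at p"
proof -
  obtain U \<phi> V \<psi> W \<kappa> where cc: "c1 = (U, \<phi>)" "c2 = (V, \<psi>)" "c3 = (W, \<kappa>)"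
    by (metis surj_pair)
  let ?F = "\<kappa> \<circ> (\<lambda>(x, y). x \<otimes> y) \<circ> inv_into (U \<times> V) (map_prod \<phi> \<psi>)"
  let ?S = "mult_domain c1 c2 c3"
  have injs: "inj_on \<phi> U" "inj_on \<psi> V" using chart_inj[OF c(1)] chart_inj[OF c(2)] cc by auto
  have inj: "inj_on (map_prod \<phi> \<psi>) (U \<times> V)" using injs by (rule map_prod_inj_on)
  have inv: "inv_into (U \<times> V) (map_prod \<phi> \<psi>) (\<phi> x, \<psi> y) = (x, y)" if "x \<in> U" "y \<in> V" for x y
    using inv_into_f_f[OF inj, of "(x, y)"] that by simp
  have eq: "?F q = mult_chart G c1 c2 c3 q" if "q \<in> ?S" for q
    using that injs by (auto simp: mult_domain_def cc mult_chart_def inv)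
  have S: "map_prod \<phi> \<psi> ` {q \<in> U \<times> V. (\<lambda>(x, y). x \<otimes> y) q \<in> W} = ?S"
    using injs by (force simp: mult_domain_def cc image_iff)
  have "(U \<times> V, map_prod \<phi> \<psi>) \<in> prod_charts (charts G) (charts G)"
    unfolding prod_charts_def using c cc by blast
  from bspec[OF conjunct2[OF mult_smooth[unfolded smooth_map_def]] this]
  have "\<forall>(W, \<kappa>)\<in>charts G. smooth_on (\<kappa> \<circ> (\<lambda>(x, y). x \<otimes> y) \<circ> inv_into (U \<times> V) (map_prod \<phi> \<psi>))
      (map_prod \<phi> \<psi> ` {q \<in> U \<times> V. (\<lambda>(x, y). x \<otimes> y) q \<in> W})"
    by (simp only: prod.case)
  from bspec[OF this c(3)] have "smooth_on ?F ?S"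
    unfolding cc(3) prod.case S[unfolded cc(3)] .
  note d = smooth_on_differentiable[OF this]
  have opn: "open ?S" using c by (rule open_mult_domain)
  \<comment> \<open>\<open>smooth_map\<close> speaks of the inverse of a product chart, which is
    matched with \<open>mult_chart\<close> on the open domain only. That both functions have the
    same derivatives there also identifies their \<open>frechet_derivative\<close>, a choice among
    these.\<close>
  have tr: "(?F has_derivative D) (at q) \<longleftrightarrow> (mult_chart G c1 c2 c3 has_derivative D) (at q)"
    if "q \<in> ?S" for q D
    using has_derivative_transform_within_open[OF _ opn that, of ?F D UNIV "mult_chart G c1 c2 c3"]
      has_derivative_transform_within_open[OF _ opn that, of "mult_chart G c1 c2 c3" D UNIV ?F] eq
    by (simp only:) blast
  show "mult_chart G c1 c2 c3 differentiable at p"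
    using d(1)[OF p] tr[OF p] unfolding differentiable_def by blast
  have eq': "frechet_derivative ?F (at q) v = frechet_derivative (mult_chart G c1 c2 c3) (at q) v"
    if "q \<in> ?S" for q
    unfolding frechet_derivative_def tr[OF that] ..
  obtain D where D: "((\<lambda>q. frechet_derivative ?F (at q) v) has_derivative D) (at p)"
    using d(2)[OF p, of v] unfolding differentiable_def by (elim exE)
  show "(\<lambda>q. frechet_derivative (mult_chart G c1 c2 c3) (at q) v) differentiable at p"
    by (rule differentiableI[OF has_derivative_transform_within_open[OF D opn p eq']])
qed

lemma id_chart: "id_chart G \<in> charts G" "\<one> \<in> fst (id_chart G)"
proof -
  have "\<exists>c. c \<in> charts G \<and> \<one> \<in> fst c" using chart_at[OF one_closed] by blast
  from someI_ex[OF this] show "id_chart G \<in> charts G" "\<one> \<in> fst (id_chart G)"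
    unfolding id_chart_def by simp_all
qed

section \<open>The chart at the identity\<close>

abbreviation "U0 \<equiv> fst (id_chart G)"
abbreviation "E \<equiv> coord G ` U0"
abbreviation "e0 \<equiv> coord G \<one>"

lemma U0_carrier: "x \<in> U0 \<Longrightarrow> x \<in> carrier G"
  using chart_carrier[OF id_chart(1)] .

lemma open_E: "open E" using chart_open_image[OF id_chart(1)] by (simp add: coord_def)

lemma e0_E: "e0 \<in> E" using id_chart(2) by blast

lemma uncoord_coord [simp]: "x \<in> U0 \<Longrightarrow> uncoord G (coord G x) = x"
  using chart_inj[OF id_chart(1)] by (simp add: uncoord_def coord_def)

lemma coord_uncoord [simp]: "z \<in> E \<Longrightarrow> coord G (uncoord G z) = z"
  by auto

lemma uncoord_U0: "z \<in> E \<Longrightarrow> uncoord G z \<in> U0"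
  by auto

lemma uncoord_e0 [simp]: "uncoord G e0 = \<one>"
  using id_chart(2) by simp

lemma uncoord_carrier: "z \<in> E \<Longrightarrow> uncoord G z \<in> carrier G"
  using uncoord_U0 U0_carrier by blast

lemma eventually_E: "eventually (\<lambda>z. z \<in> E) (nhds e0)"
  using open_E e0_E by (rule eventually_nhds_in_open)

lemma eventually_uncoord:
  assumes "continuous_map (topo G) (topo G) h" "openin (topo G) W" "h \<one> \<in> W"
  shows "eventually (\<lambda>z. z \<in> E \<and> h (uncoord G z) \<in> W) (nhds e0)"
proof -
  have "continuous_map (top_of_set E) (topo G) (h \<circ> uncoord G)"
    using continuous_map_compose[OF chart_inv_continuous[OF id_chart(1)] assms(1)]
    by (simp add: coord_def uncoord_def)
  from openin_continuous_map_preimage[OF this assms(2)]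
  have "openin (top_of_set E) {z \<in> E. h (uncoord G z) \<in> W}" by simp
  then have "open {z \<in> E. h (uncoord G z) \<in> W}" using open_E openin_open_eq by blast
  moreover have "e0 \<in> {z \<in> E. h (uncoord G z) \<in> W}" using assms(3) e0_E by simp
  ultimately show ?thesis using eventually_nhds_in_open by fastforce
qed

lemma eventually_conj:
  "s \<in> carrier G \<Longrightarrow> eventually (\<lambda>z. z \<in> E \<and> s \<otimes> uncoord G z \<otimes> inv s \<in> U0) (nhds e0)"
  using eventually_uncoord[OF conj_continuous chart_openin[OF id_chart(1)], of s] id_chart(2)
  by simp

text \<open>Conjugation is left multiplication by \<open>s\<close>, which stays in \<open>c1\<close>
  near the identity, followed by right multiplication by the fixed \<open>inv s\<close>. The
  derivative is kept explicit because it is differentiated once more, in \<open>s\<close>, to obtain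
  the bracket.\<close>

lemma conj_has_derivative_charts:
  assumes s: "s \<in> carrier G" and c: "c1 \<in> charts G" "s \<in> fst c1" "c2 \<in> charts G" "inv s \<in> fst c2"
  shows "((\<lambda>z. coord G (s \<otimes> uncoord G z \<otimes> inv s)) has_derivative
    (\<lambda>y. frechet_derivative (mult_chart G c1 c2 (id_chart G)) (at (snd c1 s, snd c2 (inv s)))
       (frechet_derivative (mult_chart G c1 (id_chart G) c1) (at (snd c1 s, e0)) (0, y), 0))) (at e0)"
proof -
  let ?F1 = "mult_chart G c1 (id_chart G) c1" and ?F2 = "mult_chart G c1 c2 (id_chart G)"
  have cc [simp]: "snd (id_chart G) = coord G" "inv_into U0 (coord G) = uncoord G"
    by (simp_all add: coord_def uncoord_def)
  have inv1 [simp]: "inv_into (fst c1) (snd c1) (snd c1 x) = x" if "x \<in> fst c1" for x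
    using chart_inj[OF c(1)] that by simp
  have inv2 [simp]: "inv_into (fst c2) (snd c2) (snd c2 x) = x" if "x \<in> fst c2" for x
    using chart_inj[OF c(3)] that by simp
  have p1: "(snd c1 s, e0) \<in> mult_domain c1 (id_chart G) c1"
    using s c id_chart by (simp add: mult_domain_def)
  have p2: "(snd c1 s, snd c2 (inv s)) \<in> mult_domain c1 c2 (id_chart G)"
    using s c id_chart by (simp add: mult_domain_def)
  have F1: "?F1 (snd c1 s, e0) = snd c1 s"
    using s c by (simp add: mult_chart_def)
  have d1: "(?F1 has_derivative frechet_derivative ?F1 (at (snd c1 s, e0))) (at (snd c1 s, e0))"
    using mult_chart_differentiable[OF c(1) id_chart(1) c(1) p1] frechet_derivative_works by blast
  have d2: "(?F2 has_derivative frechet_derivative ?F2 (at (snd c1 s, snd c2 (inv s))))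
      (at (snd c1 s, snd c2 (inv s)))"
    using mult_chart_differentiable[OF c(1,3) id_chart(1) p2] frechet_derivative_works by blast
  have "((\<lambda>z. (snd c1 s, z)) has_derivative (\<lambda>y. (0, y))) (at e0)"
    by (auto intro!: derivative_eq_intros)
  from has_derivative_compose[OF this d1]
  have "((\<lambda>z. (?F1 (snd c1 s, z), snd c2 (inv s))) has_derivative
      (\<lambda>y. (frechet_derivative ?F1 (at (snd c1 s, e0)) (0, y), 0))) (at e0)"
    by (intro has_derivative_Pair) auto
  from has_derivative_compose[OF this, of ?F2] d2
  have "((\<lambda>z. ?F2 (?F1 (snd c1 s, z), snd c2 (inv s))) has_derivative
      (\<lambda>y. frechet_derivative ?F2 (at (snd c1 s, snd c2 (inv s)))
       (frechet_derivative ?F1 (at (snd c1 s, e0)) (0, y), 0))) (at e0)"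
    by (simp add: F1)
  moreover have "eventually (\<lambda>z. ?F2 (?F1 (snd c1 s, z), snd c2 (inv s)) =
      coord G (s \<otimes> uncoord G z \<otimes> inv s)) (nhds e0)"
  proof -
    have "continuous_map (topo G) (topo G) (\<lambda>x. s \<otimes> x)"
      using continuous_map_compose[OF continuous_map_pairedI mult_continuous, of "topo G" "\<lambda>_. s" "\<lambda>x. x"] s
      by (simp add: o_def continuous_map_const continuous_map_id[unfolded id_def])
    from eventually_uncoord[OF this chart_openin[OF c(1)]] show ?thesis
      using s c by (auto simp: mult_chart_def elim!: eventually_mono)
  qed
  ultimately show ?thesis
    by (rule has_derivative_transform_nhds)
qed

section \<open>Ad as a representation, and its differentiability\<close>

lemma conj_has_derivative:
  assumes "s \<in> carrier G"
  shows "((\<lambda>z. coord G (s \<otimes> uncoord G z \<otimes> inv s)) has_derivative Ad G s) (at e0)"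
proof -
  obtain c1 c2 where "c1 \<in> charts G" "s \<in> fst c1" "c2 \<in> charts G" "inv s \<in> fst c2"
    using chart_at[OF assms] chart_at[OF inv_closed[OF assms]] by blast
  from conj_has_derivative_charts[OF assms this] show ?thesis
    unfolding Ad_def by (metis differentiableI frechet_derivative_works)
qed

lemma Ad_linear: "s \<in> carrier G \<Longrightarrow> linear (Ad G s)"
  using conj_has_derivative has_derivative_linear by blast

lemma Ad_unique:
  assumes "s \<in> carrier G" "((\<lambda>z. coord G (s \<otimes> uncoord G z \<otimes> inv s)) has_derivative D) (at e0)"
  shows "Ad G s = D"
  using has_derivative_unique[OF conj_has_derivative[OF assms(1)] assms(2)] .

lemma Ad_mult:
  assumes s: "s \<in> carrier G" and t: "t \<in> carrier G"
  shows "Ad G (s \<otimes> t) x = Ad G s (Ad G t x)"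
proof -
  have "coord G (t \<otimes> uncoord G e0 \<otimes> inv t) = e0" using t by simp
  then have "((\<lambda>z. coord G (s \<otimes> uncoord G (coord G (t \<otimes> uncoord G z \<otimes> inv t)) \<otimes> inv s))
      has_derivative (\<lambda>x. Ad G s (Ad G t x))) (at e0)"
    using has_derivative_compose[OF conj_has_derivative[OF t],
        of "\<lambda>z. coord G (s \<otimes> uncoord G z \<otimes> inv s)" "Ad G s"] conj_has_derivative[OF s]
    by simp
  moreover have "eventually (\<lambda>z. coord G (s \<otimes> uncoord G (coord G (t \<otimes> uncoord G z \<otimes> inv t)) \<otimes> inv s) =
      coord G ((s \<otimes> t) \<otimes> uncoord G z \<otimes> inv (s \<otimes> t))) (nhds e0)"
    using eventually_conj[OF t]
  proof eventually_elim
    case (elim z)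
    then have "uncoord G z \<in> carrier G" using uncoord_carrier by blast
    then show ?case using elim s t by (simp add: m_assoc inv_mult_group)
  qed
  ultimately have "((\<lambda>z. coord G ((s \<otimes> t) \<otimes> uncoord G z \<otimes> inv (s \<otimes> t)))
      has_derivative (\<lambda>x. Ad G s (Ad G t x))) (at e0)"
    by (rule has_derivative_transform_nhds)
  from Ad_unique[OF m_closed[OF s t] this] show ?thesis by simp
qed

lemma Ad_one: "Ad G \<one> x = x"
proof -
  have "((\<lambda>z. z) has_derivative (\<lambda>x. x)) (at e0)" by simp
  moreover have "eventually (\<lambda>z. z = coord G (\<one> \<otimes> uncoord G z \<otimes> inv \<one>)) (nhds e0)"
    using eventually_E
  proof eventually_elim
    case (elim z)
    then show ?case using uncoord_carrier[OF elim] by simp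
  qed
  ultimately have "((\<lambda>z. coord G (\<one> \<otimes> uncoord G z \<otimes> inv \<one>)) has_derivative (\<lambda>x. x)) (at e0)"
    by (rule has_derivative_transform_nhds)
  from Ad_unique[OF one_closed this] show ?thesis by simp
qed

lemma Ad_inv: "s \<in> carrier G \<Longrightarrow> Ad G s (Ad G (inv s) x) = x"
  and Ad_inv': "s \<in> carrier G \<Longrightarrow> Ad G (inv s) (Ad G s x) = x"
  by (simp_all add: Ad_one flip: Ad_mult)

lemma inv_chart_differentiable: "(\<lambda>z. coord G (inv (uncoord G z))) differentiable at e0"
proof -
  have id: "(U0, coord G) \<in> charts G" using id_chart(1) by (simp add: coord_def)
  from bspec[OF conjunct2[OF inv_smooth[unfolded smooth_map_def]] id]
  have "\<forall>(V, \<psi>)\<in>charts G. smooth_on (\<psi> \<circ> (\<lambda>x. inv x) \<circ> inv_into U0 (coord G))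
      (coord G ` {x \<in> U0. inv x \<in> V})"
    by (simp only: prod.case)
  from bspec[OF this id] have "smooth_on (coord G \<circ> (\<lambda>x. inv x) \<circ> inv_into U0 (coord G))
      (coord G ` {x \<in> U0. inv x \<in> U0})"
    by (simp only: prod.case)
  moreover have "e0 \<in> coord G ` {x \<in> U0. inv x \<in> U0}" using id_chart(2) by auto
  ultimately have "(coord G \<circ> (\<lambda>x. inv x) \<circ> inv_into U0 (coord G)) differentiable at e0"
    by (rule smooth_on_differentiable(1))
  then show ?thesis by (simp add: uncoord_def o_def)
qed

text \<open>In the chart at the identity, with multiplication \<open>F\<close> and inversion \<open>i\<close>,
  \<open>Ad(z) y = D\<^sub>1F(z, i z) (D\<^sub>2F(z, e) y)\<close>.\<close>

lemma Ad_differentiable: "(\<lambda>z. Ad G (uncoord G z) y) differentiable at e0"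
proof -
  let ?F = "mult_chart G (id_chart G) (id_chart G) (id_chart G)"
  let ?i = "\<lambda>z. coord G (inv (uncoord G z))"
  define w where "w z = frechet_derivative ?F (at (z, e0)) (0, y)" for z
  have cc [simp]: "snd (id_chart G) = coord G" "inv_into U0 (coord G) = uncoord G"
    by (simp_all add: coord_def uncoord_def)
  have p: "(e0, e0) \<in> mult_domain (id_chart G) (id_chart G) (id_chart G)"
    using id_chart by (simp add: mult_domain_def)
  have i0: "?i e0 = e0" by simp
  have F2: "(\<lambda>q. frechet_derivative ?F (at q) v) differentiable at (e0, e0)" for v
    using mult_chart_differentiable2[OF id_chart(1) id_chart(1) id_chart(1) p] .
  have "(\<lambda>z. (z, e0)) differentiable at e0"
    by (rule differentiableI[OF has_derivative_Pair[OF has_derivative_ident has_derivative_const]])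
  from differentiable_chain_at[OF this F2] have w: "w differentiable at e0"
    by (simp add: w_def[abs_def] o_def)
  have "(\<lambda>z. (z, ?i z)) differentiable at e0"
    using differentiableI[OF has_derivative_Pair[OF has_derivative_ident
        inv_chart_differentiable[unfolded frechet_derivative_works]]] .
  then have "(\<lambda>z. frechet_derivative ?F (at (z, ?i z)) v) differentiable at e0" for v
    using differentiable_chain_at[of "\<lambda>z. (z, ?i z)" e0] F2[of v] i0 by (simp add: o_def)
  \<comment> \<open>Differentiability in \<open>z\<close> is known for fixed directions
    \<open>v\<close> only, so the moving direction \<open>w z\<close> is expanded in the
    basis.\<close>
  then have "(\<lambda>z. \<Sum>b\<in>Basis. inner (w z) b *\<^sub>R frechet_derivative ?F (at (z, ?i z)) (b, 0)) differentiable at e0"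
    using w by (intro differentiable_sum differentiable_scaleR differentiable_inner) auto
  then obtain D where D: "((\<lambda>z. \<Sum>b\<in>Basis. inner (w z) b *\<^sub>R frechet_derivative ?F (at (z, ?i z)) (b, 0))
      has_derivative D) (at e0)" unfolding differentiable_def by blast
  have ev: "eventually (\<lambda>z. (\<Sum>b\<in>Basis. inner (w z) b *\<^sub>R frechet_derivative ?F (at (z, ?i z)) (b, 0)) =
      Ad G (uncoord G z) y) (nhds e0)"
    using eventually_uncoord[OF inv_continuous chart_openin[OF id_chart(1)], unfolded inv_one, OF id_chart(2)]
  proof eventually_elim
    case (elim z)
    then have z: "uncoord G z \<in> U0" "inv (uncoord G z) \<in> U0" "uncoord G z \<in> carrier G"
      using uncoord_U0 U0_carrier by auto
    have "Ad G (uncoord G z) = (\<lambda>y. frechet_derivative ?F (at (coord G (uncoord G z), ?i z))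
       (frechet_derivative ?F (at (coord G (uncoord G z), e0)) (0, y), 0))"
      using Ad_unique[OF z(3) conj_has_derivative_charts[OF z(3) id_chart(1) z(1) id_chart(1) z(2)]]
      by simp
    then have A: "Ad G (uncoord G z) y = frechet_derivative ?F (at (z, ?i z)) (w z, 0)"
      using elim by (simp add: w_def)
    have "(z, ?i z) \<in> mult_domain (id_chart G) (id_chart G) (id_chart G)"
      using elim z id_chart by (simp add: mult_domain_def)
    then have lin: "linear (frechet_derivative ?F (at (z, ?i z)))"
      using mult_chart_differentiable id_chart(1) linear_frechet_derivative by blast
    have "(w z, 0) = (\<Sum>b\<in>Basis. inner (w z) b *\<^sub>R (b, 0::'g))"
      by (simp add: euclidean_representation prod_eq_iff fst_sum snd_sum)
    then show ?case unfolding A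
      by (simp only: linear_sum[OF lin] linear_scale[OF lin])
  qed
  show ?thesis
    by (rule differentiableI[OF has_derivative_transform_nhds[OF D ev]])
qed

section \<open>The bracket as the derivative of Ad\<close>

lemma Ad_has_derivative: "((\<lambda>z. Ad G (uncoord G z) y) has_derivative (\<lambda>x. bracket G x y)) (at e0)"
  using Ad_differentiable[of y] unfolding frechet_derivative_works bracket_def .

text \<open>By the chain rule only the velocity at the identity matters, so the bracket can be
  computed along straight lines in the chart, their conjugates and one-parameter subgroups
  alike.\<close>

lemma Ad_curve:
  assumes g: "((\<lambda>t. coord G (g t)) has_vector_derivative x) (at t0)"
    and g0: "g t0 = \<one>" and ev: "eventually (\<lambda>t. g t \<in> U0) (nhds t0)"
  shows "((\<lambda>t. Ad G (g t) y) has_vector_derivative bracket G x y) (at t0)"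
proof -
  have lin: "linear (\<lambda>x. bracket G x y)" using Ad_has_derivative has_derivative_linear by blast
  have "((\<lambda>t. Ad G (uncoord G (coord G (g t))) y) has_derivative (\<lambda>h. bracket G (h *\<^sub>R x) y)) (at t0)"
    using has_derivative_compose[OF g[unfolded has_vector_derivative_def],
        of "\<lambda>z. Ad G (uncoord G z) y" "\<lambda>x. bracket G x y"] Ad_has_derivative[of y] g0
    by simp
  moreover have "eventually (\<lambda>t. Ad G (uncoord G (coord G (g t))) y = Ad G (g t) y) (nhds t0)"
    using ev by eventually_elim simp
  ultimately have "((\<lambda>t. Ad G (g t) y) has_derivative (\<lambda>h. bracket G (h *\<^sub>R x) y)) (at t0)"
    by (rule has_derivative_transform_nhds)
  then show ?thesis by (simp add: has_vector_derivative_def linear_scale[OF lin])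
qed

text \<open>A curve with velocity \<open>x\<close> for every \<open>x\<close> in the model space,
  whereas one-parameter subgroups are at hand only for \<open>x\<close> in some
  \<open>Lie G S\<close>.\<close>

definition line :: "'g \<Rightarrow> real \<Rightarrow> 'a" where "line x t = uncoord G (e0 + t *\<^sub>R x)"

lemma line_0 [simp]: "line x 0 = \<one>" by (simp add: line_def)

lemma line_tendsto: "eventually Q (nhds e0) \<Longrightarrow> eventually (\<lambda>t. Q (e0 + t *\<^sub>R x)) (nhds (0::real))"
proof -
  assume Q: "eventually Q (nhds e0)"
  have "((\<lambda>t. e0 + t *\<^sub>R x) \<longlongrightarrow> e0 + 0 *\<^sub>R x) (nhds (0::real))"
    by (intro tendsto_intros filterlim_ident)
  then show ?thesis using Q by (simp add: filterlim_iff)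
qed

lemma eventually_line: "eventually (\<lambda>t. line x t \<in> U0 \<and> coord G (line x t) = e0 + t *\<^sub>R x) (nhds 0)"
  using line_tendsto[OF eventually_E, of x]
  by eventually_elim (use uncoord_U0 coord_uncoord in \<open>auto simp: line_def\<close>)

lemma line_vector_derivative: "((\<lambda>t. e0 + t *\<^sub>R x) has_vector_derivative x) (at 0)"
  by (auto intro!: derivative_eq_intros)

lemma Ad_line: "((\<lambda>t. Ad G (line x t) y) has_vector_derivative bracket G x y) (at 0)"
proof (rule Ad_curve)
  show "((\<lambda>t. coord G (line x t)) has_vector_derivative x) (at 0)"
    unfolding has_vector_derivative_def
    by (rule has_derivative_transform_nhds[OF line_vector_derivative[unfolded has_vector_derivative_def]])
      (use eventually_line[of x] in \<open>auto elim: eventually_mono\<close>)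
  show "eventually (\<lambda>t. line x t \<in> U0) (nhds 0)"
    using eventually_line by eventually_elim blast
qed simp

lemma conj_line:
  assumes s: "s \<in> carrier G"
  shows "((\<lambda>t. Ad G (s \<otimes> line x t \<otimes> inv s) y) has_vector_derivative bracket G (Ad G s x) y) (at 0)"
proof (rule Ad_curve)
  have "((\<lambda>t. coord G (s \<otimes> uncoord G (e0 + t *\<^sub>R x) \<otimes> inv s)) has_derivative (\<lambda>h. Ad G s (h *\<^sub>R x))) (at 0)"
    using has_derivative_compose[OF line_vector_derivative[unfolded has_vector_derivative_def], of _ "Ad G s" x]
      conj_has_derivative[OF s] by simp
  then show "((\<lambda>t. coord G (s \<otimes> line x t \<otimes> inv s)) has_vector_derivative Ad G s x) (at 0)"
    by (simp add: has_vector_derivative_def line_def linear_scale[OF Ad_linear[OF s]])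
  show "s \<otimes> line x 0 \<otimes> inv s = \<one>" using s by simp
  show "eventually (\<lambda>t. s \<otimes> line x t \<otimes> inv s \<in> U0) (nhds 0)"
    using line_tendsto[OF eventually_conj[OF s], of x] by eventually_elim (simp add: line_def)
qed

lemma linear_bracket_left: "linear (\<lambda>x. bracket G x y)"
  using Ad_has_derivative has_derivative_linear by blast

lemma has_vector_derivative_transform_nhds:
  "(h has_vector_derivative D) (at x) \<Longrightarrow> eventually (\<lambda>y. h y = k y) (nhds x) \<Longrightarrow>
    (k has_vector_derivative D) (at x)"
  unfolding has_vector_derivative_def by (rule has_derivative_transform_nhds)

lemma linear_has_vector_derivative:
  fixes L :: "'b::euclidean_space \<Rightarrow> 'c::real_normed_vector"
  assumes "linear L" "(h has_vector_derivative D) (at x)"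
  shows "((\<lambda>t. L (h t)) has_vector_derivative L D) (at x)"
  using bounded_linear.has_vector_derivative[OF _ assms(2)] assms(1)
  by (simp add: linear_conv_bounded_linear)

text \<open>Ad acts on the second argument, so its linearity is differentiated along
  \<open>line x\<close>; near 0 the line stays in the group, where Ad is linear.\<close>

lemma linear_bracket_right: "linear (bracket G x)"
proof (rule linearI)
  have ev: "eventually (\<lambda>t. line x t \<in> carrier G) (nhds 0)"
    using eventually_line[of x] by eventually_elim (use U0_carrier in blast)
  fix y y'
  have "((\<lambda>t. Ad G (line x t) y + Ad G (line x t) y') has_vector_derivative
      bracket G x y + bracket G x y') (at 0)"
    by (intro has_vector_derivative_add Ad_line)
  then have "((\<lambda>t. Ad G (line x t) (y + y')) has_vector_derivative bracket G x y + bracket G x y') (at 0)"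
    by (rule has_vector_derivative_transform_nhds)
      (use ev in \<open>eventually_elim, simp add: linear_add[OF Ad_linear]\<close>)
  then show "bracket G x (y + y') = bracket G x y + bracket G x y'"
    using Ad_line vector_derivative_unique_at by blast
  fix c
  have "((\<lambda>t. c *\<^sub>R Ad G (line x t) y) has_vector_derivative c *\<^sub>R bracket G x y) (at 0)"
    by (rule linear_has_vector_derivative[OF linear_scaleR Ad_line])
  then have "((\<lambda>t. Ad G (line x t) (c *\<^sub>R y)) has_vector_derivative c *\<^sub>R bracket G x y) (at 0)"
    by (rule has_vector_derivative_transform_nhds)
      (use ev in \<open>eventually_elim, simp add: linear_scale[OF Ad_linear]\<close>)
  then show "bracket G x (c *\<^sub>R y) = c *\<^sub>R bracket G x y"
    using Ad_line vector_derivative_unique_at by blast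
qed

lemma bilinear_bracket: "bilinear (bracket G)"
  by (simp add: bilinear_def linear_bracket_left linear_bracket_right)

text \<open>Differentiate Ad(s) Ad(g) = Ad(s g s^-1) Ad(s) as \<open>g\<close> runs through a
  line.\<close>

lemma Ad_bracket:
  assumes s: "s \<in> carrier G"
  shows "Ad G s (bracket G x y) = bracket G (Ad G s x) (Ad G s y)"
proof -
  have "((\<lambda>t. Ad G s (Ad G (line x t) y)) has_vector_derivative Ad G s (bracket G x y)) (at 0)"
    by (rule linear_has_vector_derivative[OF Ad_linear[OF s] Ad_line])
  then have "((\<lambda>t. Ad G (s \<otimes> line x t \<otimes> inv s) (Ad G s y)) has_vector_derivative Ad G s (bracket G x y)) (at 0)"
  proof (rule has_vector_derivative_transform_nhds)
    show "eventually (\<lambda>t. Ad G s (Ad G (line x t) y) = Ad G (s \<otimes> line x t \<otimes> inv s) (Ad G s y)) (nhds 0)"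
      using eventually_line[of x]
    proof eventually_elim
      case (elim t)
      then have "line x t \<in> carrier G" using U0_carrier by blast
      then show ?case using s by (simp add: Ad_mult Ad_inv')
    qed
  qed
  then show ?thesis using conj_line[OF s] vector_derivative_unique_at by blast
qed

text \<open>Differentiate \<open>Ad_bracket\<close> along a line, with the product rule for the
  bracket of two moving vectors.\<close>

lemma bracket_leibniz:
  "bracket G x (bracket G y z) = bracket G (bracket G x y) z + bracket G y (bracket G x z)"
proof -
  have "bounded_bilinear (bracket G)" using bilinear_bracket by (simp add: bilinear_conv_bounded_bilinear)
  from bounded_bilinear.has_vector_derivative[OF this Ad_line Ad_line]
  have "((\<lambda>t. bracket G (Ad G (line x t) y) (Ad G (line x t) z)) has_vector_derivative
     bracket G y (bracket G x z) + bracket G (bracket G x y) z) (at 0)"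
    by (simp add: Ad_one)
  then have "((\<lambda>t. Ad G (line x t) (bracket G y z)) has_vector_derivative
     bracket G y (bracket G x z) + bracket G (bracket G x y) z) (at 0)"
    by (rule has_vector_derivative_transform_nhds)
      (use eventually_line[of x] in \<open>eventually_elim, use U0_carrier in \<open>auto simp: Ad_bracket\<close>\<close>)
  then show ?thesis using Ad_line vector_derivative_unique_at by (metis add.commute)
qed

section \<open>One-parameter subgroups\<close>

lemma one_param_carrier: "one_param_subgroup G x \<gamma> \<Longrightarrow> \<gamma> t \<in> carrier G"
  using continuous_map_funspace[of euclideanreal "topo G" \<gamma>] by (auto simp: one_param_subgroup_def)

lemma one_param_add: "one_param_subgroup G x \<gamma> \<Longrightarrow> \<gamma> (t + t') = \<gamma> t \<otimes> \<gamma> t'"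
  by (simp add: one_param_subgroup_def)

lemma one_param_0: "one_param_subgroup G x \<gamma> \<Longrightarrow> \<gamma> 0 = \<one>"
  using one_param_add[of x \<gamma> 0 0] one_param_carrier[of x \<gamma> 0] by (metis add_0 l_cancel_one)

lemma one_param_inv: "one_param_subgroup G x \<gamma> \<Longrightarrow> inv (\<gamma> t) = \<gamma> (- t)"
  using one_param_add[of x \<gamma> "-t" t] one_param_carrier[of x \<gamma>] one_param_0[of x \<gamma>]
  by (simp add: inv_equality)

lemma one_param_U0:
  assumes "one_param_subgroup G x \<gamma>"
  shows "eventually (\<lambda>t. \<gamma> t \<in> U0) (nhds 0)"
proof -
  have "continuous_map euclideanreal (topo G) \<gamma>" using assms by (simp add: one_param_subgroup_def)
  from openin_continuous_map_preimage[OF this chart_openin[OF id_chart(1)]]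
  have "open {t. \<gamma> t \<in> U0}" by simp
  moreover have "0 \<in> {t. \<gamma> t \<in> U0}" using one_param_0[OF assms] id_chart(2) by simp
  ultimately show ?thesis using eventually_nhds_in_open by fastforce
qed

lemma Ad_one_param:
  assumes "one_param_subgroup G x \<gamma>"
  shows "((\<lambda>t. Ad G (\<gamma> t) y) has_vector_derivative bracket G x y) (at 0)"
  using assms one_param_0[OF assms] one_param_U0[OF assms]
  by (intro Ad_curve) (auto simp: one_param_subgroup_def)

lemma one_param_conj:
  assumes s: "s \<in> carrier G" and \<gamma>: "one_param_subgroup G x \<gamma>"
  shows "one_param_subgroup G (Ad G s x) (\<lambda>t. s \<otimes> \<gamma> t \<otimes> inv s)"
  unfolding one_param_subgroup_def
proof (intro conjI allI)
  have "continuous_map euclideanreal (topo G) \<gamma>" using \<gamma> by (simp add: one_param_subgroup_def)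
  from continuous_map_compose[OF this conj_continuous[OF s]]
  show "continuous_map euclideanreal (topo G) (\<lambda>t. s \<otimes> \<gamma> t \<otimes> inv s)" by (simp add: o_def)
next
  fix t t'
  have c: "\<gamma> r \<in> carrier G" for r using one_param_carrier[OF \<gamma>] .
  have "inv s \<otimes> (s \<otimes> (\<gamma> t' \<otimes> inv s)) = \<gamma> t' \<otimes> inv s"
    using s c by (simp flip: m_assoc)
  then show "s \<otimes> \<gamma> (t + t') \<otimes> inv s = s \<otimes> \<gamma> t \<otimes> inv s \<otimes> (s \<otimes> \<gamma> t' \<otimes> inv s)"
    using s c one_param_add[OF \<gamma>] by (simp add: m_assoc)
next
  have "((\<lambda>t. coord G (\<gamma> t)) has_derivative (\<lambda>h. h *\<^sub>R x)) (at 0)"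
    using \<gamma> by (simp add: one_param_subgroup_def has_vector_derivative_def)
  from has_derivative_compose[OF this] conj_has_derivative[OF s]
  have "((\<lambda>t. coord G (s \<otimes> uncoord G (coord G (\<gamma> t)) \<otimes> inv s)) has_vector_derivative Ad G s x) (at 0)"
    using one_param_0[OF \<gamma>]
    by (simp add: has_vector_derivative_def linear_scale[OF Ad_linear[OF s]] flip: linear_scale[OF Ad_linear[OF s]])
  then show "((\<lambda>t. coord G (s \<otimes> \<gamma> t \<otimes> inv s)) has_vector_derivative Ad G s x) (at 0)"
    by (rule has_vector_derivative_transform_nhds)
      (use one_param_U0[OF \<gamma>] in \<open>eventually_elim, simp\<close>)
qed

lemma Ad_Lie:
  assumes "subgroup S G" "s \<in> S" "x \<in> Lie G S"
  shows "Ad G s x \<in> Lie G S"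
proof -
  obtain \<gamma> where \<gamma>: "one_param_subgroup G x \<gamma>" "range \<gamma> \<subseteq> S" using assms(3) by (auto simp: Lie_def)
  have "range (\<lambda>t. s \<otimes> \<gamma> t \<otimes> inv s) \<subseteq> S"
    using assms(1,2) \<gamma>(2) by (auto intro!: subgroup.m_closed subgroup.m_inv_closed)
  with one_param_conj[OF _ \<gamma>(1)] show ?thesis
    using subgroup.mem_carrier[OF assms(1,2)] unfolding Lie_def by blast
qed

lemma exp_curve: "x \<in> Lie G S \<Longrightarrow> one_param_subgroup G x (exp_curve G x)"
  unfolding Lie_def exp_curve_def using someI[of "one_param_subgroup G x"] by blast

text \<open>The inverse of s exp(t x) is exp(-t x) s^-1, so functions of the inverse move along the
  reversed subgroup.\<close>

lemma one_param_minus: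
  assumes "one_param_subgroup G x \<gamma>"
  shows "one_param_subgroup G (- x) (\<lambda>t. \<gamma> (- t))"
  unfolding one_param_subgroup_def
proof (intro conjI allI)
  have "continuous_map euclideanreal euclideanreal (\<lambda>t. - t :: real)"
    by (simp add: continuous_on_minus)
  from continuous_map_compose[OF this] assms
  show "continuous_map euclideanreal (topo G) (\<lambda>t. \<gamma> (- t))"
    by (fastforce simp: one_param_subgroup_def o_def)
  show "\<gamma> (- (t + t')) = \<gamma> (- t) \<otimes> \<gamma> (- t')" for t t'
    using one_param_add[OF assms, of "- t" "- t'"] by simp
  have "((\<lambda>t. coord G (\<gamma> t)) has_derivative (\<lambda>h. h *\<^sub>R x)) (at (- 0))"
    using assms by (simp add: one_param_subgroup_def has_vector_derivative_def)
  from has_derivative_compose[OF has_derivative_minus[OF has_derivative_ident] this]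
  show "((\<lambda>t. coord G (\<gamma> (- t))) has_vector_derivative - x) (at 0)"
    by (simp add: has_vector_derivative_def)
qed

text \<open>\<open>Ad_one_param\<close> treats a fixed vector; expanding \<open>h t\<close> in the
  basis reduces the claim to the product rule in each summand.\<close>

lemma Ad_one_param_product:
  assumes \<gamma>: "one_param_subgroup G x \<gamma>" and h: "(h has_vector_derivative h') (at 0)"
  shows "((\<lambda>t. Ad G (\<gamma> t) (h t)) has_vector_derivative bracket G x (h 0) + h') (at 0)"
proof -
  have expand: "(\<Sum>b\<in>Basis. inner v b *\<^sub>R L b) = L v" if "linear L" for L :: "'g \<Rightarrow> 'g" and v
    using linear_sum[OF that, of "\<lambda>b. inner v b *\<^sub>R b" Basis] linear_scale[OF that]
    by (simp add: euclidean_representation)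
  have "((\<lambda>t. \<Sum>b\<in>Basis. inner (h t) b *\<^sub>R Ad G (\<gamma> t) b) has_vector_derivative
      (\<Sum>b\<in>Basis. inner (h 0) b *\<^sub>R bracket G x b + inner h' b *\<^sub>R Ad G (\<gamma> 0) b)) (at 0)"
  proof (intro has_vector_derivative_sum has_vector_derivative_scaleR Ad_one_param[OF \<gamma>])
    fix b :: 'g
    show "((\<lambda>t. inner (h t) b) has_field_derivative inner h' b) (at 0)"
      using bounded_linear.has_vector_derivative[OF bounded_linear_inner_left h]
      by (simp add: has_real_derivative_iff_has_vector_derivative)
  qed
  also have "(\<lambda>t. \<Sum>b\<in>Basis. inner (h t) b *\<^sub>R Ad G (\<gamma> t) b) = (\<lambda>t. Ad G (\<gamma> t) (h t))"
    using expand[OF Ad_linear[OF one_param_carrier[OF \<gamma>]]] by simp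
  also have "(\<Sum>b\<in>Basis. inner (h 0) b *\<^sub>R bracket G x b + inner h' b *\<^sub>R Ad G (\<gamma> 0) b) =
      bracket G x (h 0) + h'"
    using expand[OF linear_bracket_right] expand[OF Ad_linear[OF one_closed]] one_param_0[OF \<gamma>]
    by (simp add: sum.distrib Ad_one)
  finally show ?thesis .
qed

end

section \<open>The nonholonomic system\<close>

locale nonholonomic_system = lie_grp G
  for G :: "('a, 'g::euclidean_space) lie_group_data" (structure) +
  fixes \<theta> :: "'g \<Rightarrow> 'g" and K :: "'a set" and \<aa> :: "'g set" and w0 :: 'g
    and \<I> :: "'g \<Rightarrow> 'g" and P :: "('g \<Rightarrow> real) set"
    and Y :: "nat \<Rightarrow> 'g" and Z e :: "('g \<Rightarrow> real) \<times> nat \<Rightarrow> 'g"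
  assumes cartan: "cartan_involution G \<theta>"
    and decomposition: "global_cartan_decomposition G \<theta> K"
    and maximal: "maximal_abelian (bracket G) (p_part \<theta>) \<aa>" and w0_a: "w0 \<in> \<aa>"
    and inertia_I: "inertia_tensor (ip G \<theta>) (k_part \<theta>) \<I>"
    and positive_P: "positive_roots (bracket G) \<aa> P"
    and adapted: "adapted_bases G \<theta> \<aa> P Y Z e"
begin

sublocale cartan_lie_algebra "bracket G" \<theta>
proof (intro cartan_lie_algebra.intro)
  show "bilinear (bracket G)" by (rule bilinear_bracket)
  show "bracket G x (bracket G y z) = bracket G (bracket G x y) z + bracket G y (bracket G x z)"
    for x y z by (rule bracket_leibniz)
  show "linear \<theta>" "\<theta> (\<theta> x) = x" "\<theta> (bracket G x y) = bracket G (\<theta> x) (\<theta> y)"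
    "x \<noteq> 0 \<Longrightarrow> - killing (bracket G) x (\<theta> x) > 0" for x y
    using cartan by (simp_all add: cartan_involution_def ip_def)
qed

lemma iprod_ip: "iprod = ip G \<theta>"
  by (simp add: iprod_def ip_def fun_eq_iff)

sublocale root_basis "bracket G" \<theta> \<aa> P Y Z w0
proof unfold_locales
  show "\<aa> \<subseteq> pp" "subspace \<aa>" using maximal by (simp_all add: maximal_abelian_def abelian_subspace_def)
  show "w0 \<in> \<aa>" by (rule w0_a)
  show "positive_roots (bracket G) \<aa> P" by (rule positive_P)
  show "orthonormal_basis iprod (m_part (bracket G) \<theta> \<aa>) {1..dim (m_part (bracket G) \<theta> \<aa>)} Y"
    "orthonormal_basis iprod (ortho iprod (m_part (bracket G) \<theta> \<aa>) \<inter> kk) (root_indices (bracket G) \<aa> P) Z"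
    using adapted unfolding iprod_ip by (simp_all add: adapted_bases_def Let_def)
  fix w \<rho> a assume *: "w \<in> \<aa>" "(\<rho>, a) \<in> root_indices (bracket G) \<aa> P"
  have "\<forall>w\<in>\<aa>. \<forall>(\<rho>, a)\<in>root_indices (bracket G) \<aa> P.
      bracket G w (Z (\<rho>, a)) = \<rho> w *\<^sub>R e (\<rho>, a) \<and> bracket G w (e (\<rho>, a)) = \<rho> w *\<^sub>R Z (\<rho>, a)"
    using adapted by (simp add: adapted_bases_def Let_def)
  from bspec[OF bspec[OF this *(1)] *(2)]
  show "bracket G w (bracket G w (Z (\<rho>, a))) = (\<rho> w)\<^sup>2 *\<^sub>R Z (\<rho>, a)"
    by (simp add: br_simps power2_eq_square)
qed

lemma K_subgroup: "subgroup K G" and Lie_K: "Lie G K = kk"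
proof -
  note * = decomposition[unfolded global_cartan_decomposition_def]
  show "subgroup K G" by (rule conjunct1[OF *])
  show "Lie G K = kk" by (rule conjunct1[OF conjunct2[OF conjunct2[OF *]]])
qed

lemma K_carrier: "s \<in> K \<Longrightarrow> s \<in> carrier G"
  using subgroup.mem_carrier[OF K_subgroup] .

lemma Ad_k: "s \<in> K \<Longrightarrow> x \<in> kk \<Longrightarrow> Ad G s x \<in> kk"
  using Ad_Lie[OF K_subgroup] Lie_K by blast

text \<open>On \<kk> the inner product is minus the Killing form, which every automorphism
  preserves.\<close>

lemma iprod_Ad: "s \<in> K \<Longrightarrow> x \<in> kk \<Longrightarrow> y \<in> kk \<Longrightarrow> iprod (Ad G s x) (Ad G s y) = iprod x y"
  using killing_automorphism[of "Ad G s" "Ad G (inv s)" x y] K_carrier[of s]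
  by (simp add: iprod_k Ad_k Ad_linear Ad_inv Ad_inv' Ad_bracket)

lemma frame:
  assumes s: "s \<in> K"
  shows "inertia_frame (bracket G) \<theta> \<aa> P Y Z w0 \<I> (Ad G s) (Ad G (inv s))"
proof (intro inertia_frame.intro inertia_frame_axioms.intro)
  have si: "inv s \<in> K" using subgroup.m_inv_closed[OF K_subgroup s] .
  note c = K_carrier[OF s] K_carrier[OF si]
  show "root_basis (bracket G) \<theta> \<aa> P Y Z w0" by (rule root_basis_axioms)
  show "inertia_tensor iprod kk \<I>" unfolding iprod_ip by (rule inertia_I)
  show "linear (Ad G s)" "linear (Ad G (inv s))" by (rule Ad_linear[OF c(1)], rule Ad_linear[OF c(2)])
  show "Ad G s (Ad G (inv s) x) = x" "Ad G (inv s) (Ad G s x) = x"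
    "Ad G s (bracket G x y) = bracket G (Ad G s x) (Ad G s y)" for x y
    using c by (simp_all add: Ad_inv Ad_inv' Ad_bracket)
  show "x \<in> kk \<Longrightarrow> Ad G s x \<in> kk" "x \<in> kk \<Longrightarrow> Ad G (inv s) x \<in> kk" for x
    using s si by (simp_all add: Ad_k)
  show "x \<in> kk \<Longrightarrow> y \<in> kk \<Longrightarrow> iprod (Ad G s x) (Ad G s y) = iprod x y" for x y
    using s by (rule iprod_Ad)
qed

lemma exp_curve_k: "x \<in> kk \<Longrightarrow> one_param_subgroup G x (exp_curve G x)"
  using exp_curve Lie_K by blast

section \<open>Derivatives along curves in TK\<close>

lemma metric_tensor_D: "metric_tensor G w0 \<I> s u = \<I> u + Ad G (inv s) (D (Ad G s u))"
  by (simp add: metric_tensor_def D_def)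

lemma Ad_translate: "s \<in> K \<Longrightarrow> x \<in> kk \<Longrightarrow>
    Ad G (s \<otimes> exp_curve G x t) y = Ad G s (Ad G (exp_curve G x t) y)"
  using Ad_mult K_carrier one_param_carrier[OF exp_curve_k] by blast

lemma Ad_inv_translate: "s \<in> K \<Longrightarrow> x \<in> kk \<Longrightarrow>
    Ad G (inv (s \<otimes> exp_curve G x t)) y = Ad G (exp_curve G x (- t)) (Ad G (inv s) y)"
  using K_carrier[of s] one_param_carrier[OF exp_curve_k] one_param_inv[OF exp_curve_k]
  by (simp add: inv_mult_group Ad_mult)

lemma line_derivative: "((\<lambda>t. u + t *\<^sub>R y) has_vector_derivative y) (at 0)"
  by (auto intro!: derivative_eq_intros)

lemma Ad_translate_derivative:
  assumes "s \<in> K" "x \<in> kk"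
  shows "((\<lambda>t. Ad G (s \<otimes> exp_curve G x t) (u + t *\<^sub>R y)) has_vector_derivative
    Ad G s (bracket G x u + y)) (at 0)"
  using linear_has_vector_derivative[OF Ad_linear[OF K_carrier[OF assms(1)]]
      Ad_one_param_product[OF exp_curve_k[OF assms(2)] line_derivative[of u y]]]
  by (simp add: Ad_translate[OF assms])

lemma Ad_inv_translate_derivative:
  assumes "s \<in> K" "x \<in> kk" "(h has_vector_derivative h') (at 0)"
  shows "((\<lambda>t. Ad G (inv (s \<otimes> exp_curve G x t)) (h t)) has_vector_derivative
    Ad G (inv s) h' - bracket G x (Ad G (inv s) (h 0))) (at 0)"
  using Ad_one_param_product[OF one_param_minus[OF exp_curve_k[OF assms(2)]]
      linear_has_vector_derivative[OF Ad_linear[OF inv_closed[OF K_carrier[OF assms(1)]]] assms(3)]]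
  by (simp add: Ad_inv_translate[OF assms(1,2)] br_simps)

text \<open>The derivative of the metric tensor applied to \<open>u\<close>, in direction
  \<open>(x, y)\<close>. The subtracted term comes from the outer factor Ad(s^-1), which moves along
  the reversed subgroup.\<close>

definition metric_dot :: "'a \<Rightarrow> 'g \<Rightarrow> 'g \<Rightarrow> 'g \<Rightarrow> 'g" where
  "metric_dot s u x y = \<I> y + (Ad G (inv s) (D (Ad G s (bracket G x u + y)))
      - bracket G x (Ad G (inv s) (D (Ad G s u))))"

lemma metric_derivative:
  assumes "s \<in> K" "x \<in> kk" "u \<in> kk" "y \<in> kk"
  shows "((\<lambda>t. metric_tensor G w0 \<I> (s \<otimes> exp_curve G x t) (u + t *\<^sub>R y)) has_vector_derivative
    metric_dot s u x y) (at 0)"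
proof -
  interpret inertia_frame "bracket G" \<theta> \<aa> P Y Z w0 \<I> "Ad G s" "Ad G (inv s)"
    using assms(1) by (rule frame)
  have "\<I> (u + t *\<^sub>R y) = \<I> u + t *\<^sub>R \<I> y" for t
    using assms subspace_k by (simp add: I_add I_scale subspace_scale)
  then have I: "((\<lambda>t. \<I> (u + t *\<^sub>R y)) has_vector_derivative \<I> y) (at 0)"
    using line_derivative[of "\<I> u" "\<I> y"] by simp
  have "s \<otimes> exp_curve G x 0 = s"
    using one_param_0[OF exp_curve_k[OF assms(2)]] K_carrier[OF assms(1)] by simp
  then show ?thesis
    using has_vector_derivative_add[OF I Ad_inv_translate_derivative[OF assms(1,2)
        linear_has_vector_derivative[OF linear_D Ad_translate_derivative[OF assms(1,2), of u y]]]]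
    unfolding metric_tensor_D metric_dot_def by simp
qed

text \<open>Moving Ad(s^-1) to the other side leaves products of vectors transported by Ad(s), on
  which the fixed map \<open>D\<close> acts.\<close>

lemma iprod_metric_dot:
  assumes "s \<in> K" "x \<in> kk" "u \<in> kk" "y \<in> kk" "v \<in> kk"
  shows "iprod (metric_dot s u x y) v = iprod (metric_tensor G w0 \<I> s y) v
    + iprod (D (bracket G (Ad G s x) (Ad G s u))) (Ad G s v)
    + iprod (D (Ad G s u)) (bracket G (Ad G s x) (Ad G s v))"
proof -
  interpret inertia_frame "bracket G" \<theta> \<aa> P Y Z w0 \<I> "Ad G s" "Ad G (inv s)"
    using assms(1) by (rule frame)
  let ?RDSu = "Ad G (inv s) (D (Ad G s u))"
  have "iprod (bracket G x ?RDSu) v = - iprod ?RDSu (bracket G x v)"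
    using br_commute[of x ?RDSu] assms(2) by (simp add: iprod_simps iprod_br_k)
  also have "\<dots> = - iprod (D (Ad G s u)) (Ad G s (bracket G x v))"
    using assms by (simp add: iprod_R D_k S_k br_k_k)
  finally show ?thesis
    using assms by (simp add: metric_dot_def metric_tensor_D iprod_simps S_simps D_simps R_simps S_br
        iprod_R D_k S_k br_k_k)
qed

lemma bounded_bilinear_iprod: "bounded_bilinear iprod"
  using linear_iprod_left linear_iprod_right by (simp add: bilinear_conv_bounded_bilinear[symmetric] bilinear_def)

lemma translate_0: "s \<in> K \<Longrightarrow> x \<in> kk \<Longrightarrow> s \<otimes> exp_curve G x 0 = s"
  using one_param_0[OF exp_curve_k] K_carrier by simp

lemma diff_TK_theta_K:
  assumes "s \<in> K" "u \<in> kk" "x \<in> kk" "y \<in> kk"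
  shows "diff_TK G (\<lambda>q. theta_K G \<theta> w0 \<I> q \<eta>) (s, u) (x, y) = iprod (metric_dot s u x y) (fst \<eta>)"
  unfolding diff_TK_def theta_K_def prod.case iprod_ip[symmetric]
  by (rule vector_derivative_at[OF linear_has_vector_derivative[OF linear_iprod_left metric_derivative[OF assms(1,3,2,4)]]])

lemma diff_TK_H_c:
  assumes "s \<in> K" "u \<in> kk" "x \<in> kk" "y \<in> kk"
  shows "diff_TK G (H_c G \<theta> w0 \<I>) (s, u) (x, y) =
    inertia_frame.energy_diff (bracket G) \<theta> w0 \<I> (Ad G s) (Ad G (inv s)) u x y"
proof -
  interpret inertia_frame "bracket G" \<theta> \<aa> P Y Z w0 \<I> "Ad G s" "Ad G (inv s)"
    using assms(1) by (rule frame)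
  have mu: "metric_tensor G w0 \<I> s v = mu v" for v by (simp add: metric_tensor_D mu_def)
  let ?M = "\<lambda>t. metric_tensor G w0 \<I> (s \<otimes> exp_curve G x t) (u + t *\<^sub>R y)"
  have "((\<lambda>t. 1/2 * iprod (?M t) (u + t *\<^sub>R y)) has_vector_derivative
      1/2 * (iprod (mu u) y + iprod (metric_dot s u x y) u)) (at 0)"
    using has_vector_derivative_mult_right[OF bounded_bilinear.has_vector_derivative[OF bounded_bilinear_iprod
        metric_derivative[OF assms(1,3,2,4)] line_derivative[of u y]], of "1/2"]
    by (simp add: mu translate_0 assms)
  then have "diff_TK G (H_c G \<theta> w0 \<I>) (s, u) (x, y) = 1/2 * (iprod (mu u) y + iprod (metric_dot s u x y) u)"
    unfolding diff_TK_def H_c_def prod.case iprod_ip[symmetric] by (rule vector_derivative_at)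
  moreover have "iprod (D (bracket G (Ad G s x) (Ad G s u))) (Ad G s u) =
      iprod (D (Ad G s u)) (bracket G (Ad G s x) (Ad G s u))"
    using iprod_D iprod_commute by metis
  ultimately show ?thesis
    using iprod_mu_commute[of y u] assms by (simp add: iprod_metric_dot mu energy_diff_def)
qed

lemma Omega_K_eq:
  assumes "s \<in> K" "u \<in> kk" "x \<in> kk" "y \<in> kk" "x' \<in> kk" "y' \<in> kk"
  shows "Omega_K G \<theta> w0 \<I> (s, u) (x, y) (x', y') =
    inertia_frame.Omega_alg (bracket G) \<theta> w0 \<I> (Ad G s) (Ad G (inv s)) u x y x' y'"
proof -
  interpret inertia_frame "bracket G" \<theta> \<aa> P Y Z w0 \<I> "Ad G s" "Ad G (inv s)"
    using assms(1) by (rule frame)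
  have mu: "metric_tensor G w0 \<I> s v = mu v" for v by (simp add: metric_tensor_D mu_def)
  have "theta_K G \<theta> w0 \<I> (s, u) (bracket G x x', 0) = iprod (mu u) (bracket G x x')"
    by (simp add: theta_K_def iprod_ip mu)
  then have "Omega_K G \<theta> w0 \<I> (s, u) (x, y) (x', y') =
      iprod (metric_dot s u x' y') x - iprod (metric_dot s u x y) x' + iprod (mu u) (bracket G x x')"
    using assms by (simp add: Omega_K_def ext_d_TK_def diff_TK_theta_K)
  then show ?thesis
    using assms br_commute[of "Ad G s x'" "Ad G s x"]
    by (simp add: iprod_metric_dot mu Omega_alg_def iprod_mu[OF assms(2) br_k_k[OF assms(3,5)]] S_br iprod_simps)
qed

lemma diff_K_connection_form:
  assumes "s \<in> K" "x \<in> kk"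
  shows "diff_K G (\<lambda>r. connection_form G w0 r y) s x = - bracket G (Ad G s (bracket G x y)) w0"
proof -
  have "((\<lambda>t. - bracket G (Ad G (s \<otimes> exp_curve G x t) y) w0) has_vector_derivative
      - bracket G (Ad G s (bracket G x y)) w0) (at 0)"
    using has_vector_derivative_minus[OF linear_has_vector_derivative[OF linear_br_left
        Ad_translate_derivative[OF assms, of y 0]]] by simp
  then show ?thesis unfolding diff_K_def connection_form_def by (rule vector_derivative_at)
qed

lemma A_dA_eq:
  assumes "s \<in> K" "x \<in> kk" "x' \<in> kk"
  shows "A_dA G \<theta> w0 (s, u) (x, y) (x', y') =
    iprod (D (Ad G s u)) (bracket G (Ad G s x) (Ad G s x'))"
proof -
  note lin = Ad_linear[OF K_carrier[OF assms(1)]]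
  have "bracket G (Ad G s (bracket G x' x)) w0 = - bracket G (Ad G s (bracket G x x')) w0"
    using br_commute[of x' x] by (simp add: linear_neg[OF lin] br_simps)
  \<comment> \<open>Each derivative term, with its sign, is the connection form at [x, x'], and the
    bracket term takes one copy away.\<close>
  then have "ext_d_K G (connection_form G w0) s x x' = - bracket G (Ad G s (bracket G x x')) w0"
    unfolding ext_d_K_def diff_K_connection_form[OF assms(1,2)] diff_K_connection_form[OF assms(1,3)]
    by (simp add: connection_form_def)
  then have "A_dA G \<theta> w0 (s, u) (x, y) (x', y') =
      iprod (bracket G w0 (Ad G s u)) (bracket G w0 (Ad G s (bracket G x x')))"
    using br_commute[of "Ad G s u" w0] br_commute[of "Ad G s (bracket G x x')" w0]
    by (simp add: A_dA_def connection_form_def iprod_ip[symmetric])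
  then show ?thesis
    using K_carrier[OF assms(1)] by (simp add: iprod_D_br Ad_bracket)
qed

lemma Lambda_eq:
  assumes "s \<in> K" "u \<in> kk" "fst \<xi> \<in> kk" "fst \<eta> \<in> kk"
  shows "Lambda G \<theta> \<aa> w0 P Y Z (s, u) \<xi> \<eta> =
    Lambda_alg (Ad G s u) (Ad G s (fst \<xi>)) (Ad G s (fst \<eta>))"
  unfolding Lambda_def Let_def struct_const_def coord_fun_def coord_form_def wedge_def prod.case
    iprod_ip[symmetric]
  by (rule Lambda_expansion) (use assms Ad_k in auto)

text \<open>Differentiate the constant curve \<open>Ad G (\<gamma> t) w0\<close> at 0. Elements of
  \<hh> are used below only through these two properties.\<close>

lemma stab_Lie:
  assumes "T \<in> Lie G (stab G K w0)"
  shows "T \<in> kk" "bracket G w0 T = 0"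
proof -
  obtain \<gamma> where \<gamma>: "one_param_subgroup G T \<gamma>" "range \<gamma> \<subseteq> stab G K w0"
    using assms by (auto simp: Lie_def)
  then have "range \<gamma> \<subseteq> K" by (auto simp: stab_def)
  with \<gamma>(1) show "T \<in> kk" using Lie_K by (auto simp: Lie_def)
  have "Ad G (\<gamma> t) w0 = w0" for t using \<gamma>(2) by (auto simp: stab_def)
  then have "((\<lambda>t. w0) has_vector_derivative bracket G T w0) (at (0::real))"
    using Ad_one_param[OF \<gamma>(1), of w0] by simp
  then have "bracket G T w0 = 0"
    using has_vector_derivative_const vector_derivative_unique_at by blast
  then show "bracket G w0 T = 0" using br_commute[of w0 T] by simp
qed

text \<open>The contribution of \<open>D\<close> through the motion of Ad(s^-1) T cancels against
  that of the metric tensor, and the rest vanishes by \<open>D T = 0\<close>. This leaves the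
  expression in \<open>Omega_alg_generator\<close>.\<close>

lemma diff_TK_J_H:
  assumes "s \<in> K" "u \<in> kk" "x \<in> kk" "y \<in> kk" and T: "T \<in> kk" "bracket G w0 T = 0"
  shows "diff_TK G (J_H G \<theta> w0 \<I> T) (s, u) (x, y) =
    iprod (\<I> y) (Ad G (inv s) T) - iprod (\<I> u) (bracket G x (Ad G (inv s) T))"
proof -
  interpret inertia_frame "bracket G" \<theta> \<aa> P Y Z w0 \<I> "Ad G s" "Ad G (inv s)"
    using assms(1) by (rule frame)
  let ?Ts = "Ad G (inv s) T"
  have mu: "metric_tensor G w0 \<I> s v = mu v" for v by (simp add: metric_tensor_D mu_def)
  have Ts: "?Ts \<in> kk" using T by (simp add: R_k)
  have "((\<lambda>t. Ad G (inv (s \<otimes> exp_curve G x t)) T) has_vector_derivative - bracket G x ?Ts) (at 0)"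
    using Ad_inv_translate_derivative[OF assms(1,3) has_vector_derivative_const] by (simp add: R_simps)
  from bounded_bilinear.has_vector_derivative[OF bounded_bilinear_iprod metric_derivative[OF assms(1,3,2,4)] this]
  have "((\<lambda>t. iprod (metric_tensor G w0 \<I> (s \<otimes> exp_curve G x t) (u + t *\<^sub>R y))
      (Ad G (inv (s \<otimes> exp_curve G x t)) T)) has_vector_derivative
      iprod (mu u) (- bracket G x ?Ts) + iprod (metric_dot s u x y) ?Ts) (at 0)"
    by (simp add: mu translate_0 assms)
  then have "diff_TK G (J_H G \<theta> w0 \<I> T) (s, u) (x, y) =
      iprod (mu u) (- bracket G x ?Ts) + iprod (metric_dot s u x y) ?Ts"
    unfolding diff_TK_def J_H_def prod.case iprod_ip[symmetric] by (rule vector_derivative_at)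
  moreover have "iprod (D a) T = 0" for a
    using iprod_D[of a T] T D_eq_0[of T] by (simp add: iprod_simps)
  ultimately show ?thesis
    using assms Ts by (simp add: iprod_metric_dot mu iprod_mu br_k_k S_br iprod_simps)
qed

section \<open>Nondegeneracy, invariance, dynamics and the momentum map\<close>

lemma nondegenerate_Omega_tilde: "nondegenerate K \<theta> (Omega_tilde G \<theta> \<aa> w0 \<I> P Y Z)"
  unfolding nondegenerate_def
proof (intro ballI impI)
  fix p \<xi> assume "p \<in> TK K \<theta>" "\<xi> \<in> TTK \<theta>" and 0: "\<forall>\<eta>\<in>TTK \<theta>. Omega_tilde G \<theta> \<aa> w0 \<I> P Y Z p \<xi> \<eta> = 0"
  then obtain s u x y where p: "p = (s, u)" "\<xi> = (x, y)" "s \<in> K" "u \<in> kk" "x \<in> kk" "y \<in> kk"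
    by (auto simp: TK_def TTK_def)
  interpret inertia_frame "bracket G" \<theta> \<aa> P Y Z w0 \<I> "Ad G s" "Ad G (inv s)"
    using p(3) by (rule frame)
  note z = subspace_0[OF subspace_k]
  have pz: "perp_comp 0 = 0" by (simp add: perp_comp_def root_comp_def iprod_simps)
  have eq: "Omega_alg u x y x' y' + Lambda_alg (Ad G s u) (Ad G s x) (Ad G s x') = 0"
    if "x' \<in> kk" "y' \<in> kk" for x' y'
    using 0 that p by (force simp: TTK_def Omega_tilde_def Omega_K_eq Lambda_eq)
  have "x = 0 \<and> y = 0"
    using Omega_alg_plus_nondegenerate[OF p(5,6,4), of "Lambda_alg (Ad G s u)"] eq
    by (simp add: Lambda_alg_def pz D_simps br_simps iprod_simps)
  then show "\<xi> = 0" using p by (simp add: prod_eq_iff)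
qed

text \<open>Moving the base point by \<open>h\<close> applies Ad(h) to every vector Ad(s) x. It thus
  suffices that Ad(h) is an automorphism that is isometric on \<kk> and commutes with
  \<open>D\<close>.\<close>

lemma H_invariant_Lambda: "H_invariant G \<theta> K w0 (Lambda G \<theta> \<aa> w0 P Y Z)"
  and H_invariant_Omega_tilde: "H_invariant G \<theta> K w0 (Omega_tilde G \<theta> \<aa> w0 \<I> P Y Z)"
proof -
  have "Lambda G \<theta> \<aa> w0 P Y Z (h \<otimes> s, u) \<xi> \<eta> = Lambda G \<theta> \<aa> w0 P Y Z (s, u) \<xi> \<eta> \<and>
      Omega_K G \<theta> w0 \<I> (h \<otimes> s, u) \<xi> \<eta> = Omega_K G \<theta> w0 \<I> (s, u) \<xi> \<eta>"
    if hyp: "h \<in> stab G K w0" "(s, u) \<in> TK K \<theta>" "\<xi> \<in> TTK \<theta>" "\<eta> \<in> TTK \<theta>" for h s u \<xi> \<eta>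
  proof
    obtain x y x' y' where v: "\<xi> = (x, y)" "\<eta> = (x', y')" "x \<in> kk" "y \<in> kk" "x' \<in> kk" "y' \<in> kk"
      using hyp by (auto simp: TTK_def)
    have h: "h \<in> K" "Ad G h w0 = w0" "s \<in> K" "u \<in> kk"
      using hyp by (auto simp: stab_def TK_def)
    have hs: "h \<otimes> s \<in> K" using h K_subgroup by (simp add: subgroup.m_closed)
    have c: "h \<in> carrier G" "s \<in> carrier G" using h K_carrier by auto
    have hi: "inv h \<in> K" using h K_subgroup by (simp add: subgroup.m_inv_closed)
    have D_Ad: "D (Ad G h a) = Ad G h (D a)" for a
      using c h(2) Ad_bracket[of h w0] by (simp add: D_def)
    have inv: "Lambda_alg (Ad G h a) (Ad G h b) (Ad G h d) = Lambda_alg a b d"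
      if "a \<in> kk" "b \<in> kk" "d \<in> kk" for a b d
      by (rule Lambda_alg_invariant[where \<psi> = "Ad G (inv h)"])
        (use that c h hi in \<open>simp_all add: Ad_linear Ad_inv Ad_inv' Ad_bracket Ad_k iprod_Ad\<close>)
    show "Lambda G \<theta> \<aa> w0 P Y Z (h \<otimes> s, u) \<xi> \<eta> = Lambda G \<theta> \<aa> w0 P Y Z (s, u) \<xi> \<eta>"
      using v h hs c by (simp add: Lambda_eq Ad_mult inv Ad_k)
    interpret F1: inertia_frame "bracket G" \<theta> \<aa> P Y Z w0 \<I> "Ad G s" "Ad G (inv s)"
      using h(3) by (rule frame)
    interpret F2: inertia_frame "bracket G" \<theta> \<aa> P Y Z w0 \<I> "Ad G (h \<otimes> s)" "Ad G (inv (h \<otimes> s))"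
      using hs by (rule frame)
    \<comment> \<open>The factors Ad(h) and its inverse on the two sides of \<open>D\<close>
      cancel.\<close>
    have mu: "F2.mu a = F1.mu a" for a
      unfolding F1.mu_def F2.mu_def using c by (simp add: Ad_mult inv_mult_group D_Ad Ad_inv')
    show "Omega_K G \<theta> w0 \<I> (h \<otimes> s, u) \<xi> \<eta> = Omega_K G \<theta> w0 \<I> (s, u) \<xi> \<eta>"
      using v h hs c
      by (simp add: Omega_K_eq F1.Omega_alg_def F2.Omega_alg_def mu Ad_mult D_Ad iprod_Ad Ad_k D_k br_k_k
          flip: Ad_bracket)
  qed
  then show "H_invariant G \<theta> K w0 (Lambda G \<theta> \<aa> w0 P Y Z)"
    "H_invariant G \<theta> K w0 (Omega_tilde G \<theta> \<aa> w0 \<I> P Y Z)"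
    unfolding H_invariant_def Omega_tilde_def by auto
qed

lemma Lambda_generator:
  assumes "T \<in> Lie G (stab G K w0)" "p \<in> TK K \<theta>" "\<eta> \<in> TTK \<theta>"
  shows "Lambda G \<theta> \<aa> w0 P Y Z p (gen G T p) \<eta> = 0"
proof -
  obtain s u where p: "p = (s, u)" "s \<in> K" "u \<in> kk" using assms(2) by (auto simp: TK_def)
  have "inv s \<in> K" using p K_subgroup by (simp add: subgroup.m_inv_closed)
  then have "Ad G (inv s) T \<in> kk" using stab_Lie[OF assms(1)] Ad_k by blast
  then show ?thesis
    using p assms(3) stab_Lie[OF assms(1)] K_carrier[OF p(2)]
    by (auto simp: gen_def Lambda_eq TTK_def Ad_inv Lambda_alg_horizontal)
qed

lemma H_basic_Lambda: "H_basic G \<theta> K w0 (Lambda G \<theta> \<aa> w0 P Y Z)"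
  unfolding H_basic_def H_horizontal_def using H_invariant_Lambda Lambda_generator by blast

lemma Omega_tilde_X_nh:
  assumes "p \<in> TK K \<theta>" "\<eta> \<in> TTK \<theta>"
  shows "Omega_tilde G \<theta> \<aa> w0 \<I> P Y Z p (X_nh G \<theta> w0 \<I> p) \<eta> = diff_TK G (H_c G \<theta> w0 \<I>) p \<eta>"
proof -
  obtain s u where p: "p = (s, u)" "s \<in> K" "u \<in> kk" using assms(1) by (auto simp: TK_def)
  interpret inertia_frame "bracket G" \<theta> \<aa> P Y Z w0 \<I> "Ad G s" "Ad G (inv s)"
    using p(2) by (rule frame)
  obtain y where y: "y \<in> kk" and
    sol: "\<And>x y'. x \<in> kk \<and> y' \<in> kk \<and> (\<forall>x'\<in>kk. \<forall>y''\<in>kk. Omega_alg u x y' x' y'' +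
       iprod (D (Ad G s u)) (bracket G (Ad G s x) (Ad G s x')) = energy_diff u x' y'') \<longleftrightarrow> x = u \<and> y' = y"
    using nonholonomic_solution[OF p(3)] by blast
  \<comment> \<open>Unique solvability is what allows the definite description in
    \<open>X_nh\<close> to be evaluated.\<close>
  have "(\<xi> \<in> TTK \<theta> \<and> (\<forall>\<eta>\<in>TTK \<theta>. Omega_K G \<theta> w0 \<I> p \<xi> \<eta> + A_dA G \<theta> w0 p \<xi> \<eta> =
      diff_TK G (H_c G \<theta> w0 \<I>) p \<eta>)) \<longleftrightarrow> \<xi> = (u, y)" for \<xi>
  proof -
    obtain x y' where \<xi>: "\<xi> = (x, y')" by (cases \<xi>)
    show ?thesis
      unfolding \<xi> p(1) TTK_def prod.inject sol[symmetric] using p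
      by (auto simp: Omega_K_eq A_dA_eq diff_TK_H_c)
  qed
  then have X: "X_nh G \<theta> w0 \<I> p = (u, y)" unfolding X_nh_def by simp
  obtain x' y' where \<eta>: "\<eta> = (x', y')" "x' \<in> kk" "y' \<in> kk" using assms(2) by (auto simp: TTK_def)
  have "Omega_alg u u y x' y' + iprod (D (Ad G s u)) (bracket G (Ad G s u) (Ad G s x')) = energy_diff u x' y'"
    using sol[of u y] \<eta> by blast
  then show ?thesis
    unfolding X unfolding p(1) \<eta>(1) using p \<eta> y
    by (simp add: Omega_tilde_def Omega_K_eq Lambda_eq Lambda_alg_diagonal S_k diff_TK_H_c)
qed

lemma Omega_tilde_generator:
  assumes "T \<in> Lie G (stab G K w0)" "p \<in> TK K \<theta>" "\<eta> \<in> TTK \<theta>"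
  shows "Omega_tilde G \<theta> \<aa> w0 \<I> P Y Z p (gen G T p) \<eta> = diff_TK G (J_H G \<theta> w0 \<I> T) p \<eta>"
proof -
  obtain s u x' y' where p: "p = (s, u)" "s \<in> K" "u \<in> kk" and \<eta>: "\<eta> = (x', y')" "x' \<in> kk" "y' \<in> kk"
    using assms(2,3) by (auto simp: TK_def TTK_def)
  interpret inertia_frame "bracket G" \<theta> \<aa> P Y Z w0 \<I> "Ad G s" "Ad G (inv s)"
    using p(2) by (rule frame)
  note T = stab_Lie[OF assms(1)]
  have "Omega_K G \<theta> w0 \<I> p (gen G T p) \<eta> = diff_TK G (J_H G \<theta> w0 \<I> T) p \<eta>"
    unfolding p(1) \<eta>(1) gen_def prod.case using p \<eta> T subspace_0[OF subspace_k]
    by (simp add: Omega_K_eq R_k Omega_alg_generator diff_TK_J_H)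
  then show ?thesis
    using Lambda_generator[OF assms] by (simp add: Omega_tilde_def)
qed

end

theorem theorem3p5:
  fixes G :: "('a, 'g::euclidean_space) lie_group_data"
    and \<theta> :: "'g \<Rightarrow> 'g" and K :: "'a set" and \<aa> :: "'g set" and w0 :: 'g
    and \<I> :: "'g \<Rightarrow> 'g" and P :: "('g \<Rightarrow> real) set"
    and Y :: "nat \<Rightarrow> 'g" and Z e :: "('g \<Rightarrow> real) \<times> nat \<Rightarrow> 'g"
  assumes "lie_group G" and "semisimple (bracket G)"
    and "cartan_involution G \<theta>" and "global_cartan_decomposition G \<theta> K"
    and "maximal_abelian (bracket G) (p_part \<theta>) \<aa>" and "w0 \<in> \<aa>"
    and "inertia_tensor (ip G \<theta>) (k_part \<theta>) \<I>"
    and "positive_roots (bracket G) \<aa> P"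
    and "adapted_bases G \<theta> \<aa> P Y Z e"
  shows
    "(nondegenerate K \<theta> (Omega_tilde G \<theta> \<aa> w0 \<I> P Y Z) \<and>
      H_invariant G \<theta> K w0 (Omega_tilde G \<theta> \<aa> w0 \<I> P Y Z) \<and>
      H_basic G \<theta> K w0 (Lambda G \<theta> \<aa> w0 P Y Z)) \<and>
     (\<forall>p\<in>TK K \<theta>. \<forall>\<eta>\<in>TTK \<theta>.
        Omega_tilde G \<theta> \<aa> w0 \<I> P Y Z p (X_nh G \<theta> w0 \<I> p) \<eta> =
        diff_TK G (H_c G \<theta> w0 \<I>) p \<eta>) \<and>
     (\<forall>T\<in>Lie G (stab G K w0). \<forall>p\<in>TK K \<theta>. \<forall>\<eta>\<in>TTK \<theta>.
        Omega_tilde G \<theta> \<aa> w0 \<I> P Y Z p (gen G T p) \<eta> =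
        diff_TK G (J_H G \<theta> w0 \<I> T) p \<eta>)"
proof -
  interpret nonholonomic_system G \<theta> K \<aa> w0 \<I> P Y Z e
    using assms by unfold_locales
  show ?thesis
    using nondegenerate_Omega_tilde H_invariant_Omega_tilde H_basic_Lambda
      Omega_tilde_X_nh Omega_tilde_generator by blast
qed

end
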